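(* Each hereditarily unicoherent metric continuum is a retract of a separable Bellamy continuum. That is, for each hereditarily unicoherent metric continuum $Y$ there exist a separable Bellamy continuum $Z$ containing (a homeomorphic copy of) $Y$ as a subspace and a continuous map $r : Z \to Y$ whose restriction to $Y$ is the identity.
   Context: A continuum is a nondegenerate (more than one point) compact connected Hausdorff space; a subcontinuum is a subspace that is itself a continuum. A metric continuum is a metrisable continuum. A continuum is indecomposable if it is not the union of two proper subcontinua. The composant $\kappa(x)$ of a point $x$ of a continuum $X$ is the union of all proper subcontinua of $X$ that contain $x$. A Bellamy continuum is an indecomposable (Hausdorff) continuum with exactly one composant. A continuum $X$ is hereditarily unicoherent if the intersection of any two subcontinua of $X$ is empty or connected. A space is separable if it has a countable dense subset. *)

theory Defs
  imports "HOL-Analysis.Analysis"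
begin

definition continuum :: "'a topology \<Rightarrow> bool" where
  "continuum X \<longleftrightarrow>
     compact_space X \<and> connected_space X \<and> Hausdorff_space X \<and>
     (\<exists>x\<in>topspace X. \<exists>y\<in>topspace X. x \<noteq> y)"

definition metric_continuum :: "'a topology \<Rightarrow> bool" where
  "metric_continuum X \<longleftrightarrow> continuum X \<and> metrizable_space X"

definition subcontinuum :: "'a topology \<Rightarrow> 'a set \<Rightarrow> bool" where
  "subcontinuum X S \<longleftrightarrow> S \<subseteq> topspace X \<and> continuum (subtopology X S)"

definition proper_subcontinuum :: "'a topology \<Rightarrow> 'a set \<Rightarrow> bool" where
  "proper_subcontinuum X S \<longleftrightarrow> subcontinuum X S \<and> S \<noteq> topspace X"

definition indecomposable :: "'a topology \<Rightarrow> bool" where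
  "indecomposable X \<longleftrightarrow>
     \<not> (\<exists>A B. proper_subcontinuum X A \<and> proper_subcontinuum X B \<and> topspace X = A \<union> B)"

definition composant :: "'a topology \<Rightarrow> 'a \<Rightarrow> 'a set" where
  "composant X x = \<Union>{S. proper_subcontinuum X S \<and> x \<in> S}"

definition bellamy_continuum :: "'a topology \<Rightarrow> bool" where
  "bellamy_continuum X \<longleftrightarrow>
     continuum X \<and> indecomposable X \<and> (\<exists>!C. C \<in> composant X ` topspace X)"

definition hereditarily_unicoherent :: "'a topology \<Rightarrow> bool" where
  "hereditarily_unicoherent X \<longleftrightarrow>
     (\<forall>A B. subcontinuum X A \<and> subcontinuum X B \<longrightarrow> A \<inter> B = {} \<or> connectedin X (A \<inter> B))"

text \<open>
  An existential statement about spaces has to fix the type of their points. Every separable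
  Hausdorff space is homeomorphic to one whose points are of type \<^typ>\<open>nat set set\<close>, so
  that type is large enough for quantifying over separable continua up to homeomorphism.
\<close>

lemma homeomorphic_space_inj_on:
  assumes "inj_on f (topspace X)"
  shows "\<exists>Z. topspace Z = f ` topspace X \<and> X homeomorphic_space Z"
proof -
  let ?g = "inv_into (topspace X) f"
  let ?Z = "pullback_topology (f ` topspace X) ?g X"
  have top: "topspace ?Z = f ` topspace X"
    by (auto simp: topspace_pullback_topology inv_into_into)
  have gf: "?g (f x) = x" if "x \<in> topspace X" for x
    using assms that by simp
  have "continuous_map ?Z X ?g"
    using continuous_map_pullback[OF continuous_map_id] by (simp add: o_def)
  moreover have "continuous_map X ?Z f"
  proof (rule continuous_map_pullback')
    show "continuous_map X X (?g \<circ> f)"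
      by (rule continuous_map_eq[OF continuous_map_id]) (simp add: gf)
  qed auto
  ultimately have "homeomorphic_maps X ?Z f ?g"
    unfolding homeomorphic_maps_def top using gf by (auto simp: f_inv_into_f)
  with top show ?thesis
    unfolding homeomorphic_space_def by blast
qed

lemma separable_Hausdorff_space_nat_set_set:
  assumes "separable_space X" "Hausdorff_space X"
  shows "\<exists>Z :: nat set set topology. X homeomorphic_space Z"
proof -
  obtain D where D: "countable D" "D \<subseteq> topspace X" "X closure_of D = topspace X"
    using assms(1) unfolding separable_space_def by blast
  have meets: "\<exists>d\<in>D. d \<in> U" if "openin X U" "x \<in> U" for U x
    using D(3) that openin_subset[OF that(1)] unfolding closure_of_def by blast
  define f where "f x = {to_nat_on D ` (D \<inter> U) | U. openin X U \<and> x \<in> U}" for x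
  have "inj_on f (topspace X)"
  proof (rule inj_onI, rule ccontr)
    fix x y assume xy: "x \<in> topspace X" "y \<in> topspace X" "f x = f y" "x \<noteq> y"
    then obtain U V where UV: "openin X U" "openin X V" "x \<in> U" "y \<in> V" "disjnt U V"
      using assms(2) unfolding Hausdorff_space_def by meson
    have "to_nat_on D ` (D \<inter> U) \<in> f y"
      unfolding xy(3)[symmetric] unfolding f_def using UV(1,3) by blast
    then obtain W where W: "openin X W" "y \<in> W" "to_nat_on D ` (D \<inter> U) = to_nat_on D ` (D \<inter> W)"
      unfolding f_def by blast
    have "D \<inter> U = D \<inter> W"
      using W(3) by (simp add: inj_on_image_eq_iff[OF inj_on_to_nat_on[OF D(1)]])
    moreover obtain d where "d \<in> D" "d \<in> W \<inter> V"
      using meets[of "W \<inter> V" y] W(1,2) UV(2,4) by auto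
    ultimately show False
      using UV(5) unfolding disjnt_def by blast
  qed
  from homeomorphic_space_inj_on[OF this] show ?thesis by blast
qed

end

theory Submission
  imports Defs
begin

text \<open>
  A continuum is Bellamy as soon as it is indecomposable and any two of its points lie in a common
  proper subcontinuum. The proof suspends a symbolic dynamical system over \<open>Y\<close> so that both
  properties can be read off from the combinatorics of a single binary array.

  The cell. \<open>Y\<close> is the middle slice of a compact \<open>D \<subseteq> Y \<times> [-1, 1]\<close> that meets each of the two
  extreme heights in one point, both over the same \<open>p\<close>, and that is irreducible between these two
  ends (\<open>cell_exists\<close>).

  The suspension. Let \<open>T\<close> be the closure of the shift orbit of a binary array \<open>u(i, m)\<close>, with rows
  \<open>i\<close> and integer positions \<open>m\<close>. In \<open>T \<times> D\<close> the top end over \<open>t\<close> is glued to the bottom end over the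
  shifted array. The result \<open>Z\<close> projects onto \<open>Y\<close>, because the glued points lie over \<open>p\<close>, and
  \<open>y \<mapsto> (u, (y, 0))\<close> is a section of this projection. The orbit of \<open>u\<close> is countable and dense in \<open>T\<close>,
  so \<open>Z\<close> is separable.

  The array. Its rows are indexed by sets \<open>A\<close> of naturals, and row \<open>A\<close> marks the sums of distinct
  powers \<open>4 ^ l\<close> with \<open>l \<in> A\<close>. Around position \<open>4 ^ l\<close> a row repeats its beginning if \<open>l \<in> A\<close> and
  vanishes otherwise. Independence of the family of sets therefore lets finitely many rows recur
  while another one vanishes (\<open>mark_recurrent\<close>). If moreover no infinite set is almost contained in
  all members of the family, then a limit of shifts of \<open>u\<close> without a zero row is itself a shift of
  \<open>u\<close> (\<open>mark_limit_cases\<close>).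

  One composant. Erasing row \<open>i\<close> from \<open>u\<close> gives an array that recurrence places in \<open>T\<close>; the part of
  \<open>Z\<close> over its orbit closure is a proper subcontinuum and contains every point of \<open>Z\<close> whose row \<open>i\<close>
  is zero. The part of \<open>Z\<close> over the closure of a backward half orbit of \<open>u\<close> is a proper subcontinuum
  as well. All of them contain the cell over the zero array, since \<open>u\<close> vanishes at negative
  positions, and together they cover \<open>Z\<close> (\<open>Z_cases\<close>, \<open>joined_Z\<close>).

  Indecomposability. Let a subcontinuum \<open>A\<close> with interior miss an open set \<open>V\<close>. By recurrence the
  chain of cells through a point in the interior of \<open>A\<close> meets \<open>V\<close> on both sides of it, and
  irreducibility of the cells cuts the chain there. The stretch between the two cuts, taken over a
  small clopen set of arrays, is relatively clopen outside \<open>V\<close>, hence contains \<open>A\<close>. But one more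
  recurrence, with a row that vanishes, gives an interior point of \<open>A\<close> outside this stretch
  (\<open>subcontinuum_with_interior\<close>).
\<close>

section \<open>Independent families without a pseudo-intersection\<close>

text \<open>
  For \<open>Q = {}\<close> the intersection is the set of all naturals, so the members of the family are
  coinfinite. Infinite pure intersections \<open>\<Inter>Q\<close> imply that a finite family has a pseudo-intersection,
  so that a family without one is infinite.
\<close>
definition strongly_independent :: "nat set set \<Rightarrow> bool" where
  "strongly_independent \<F> \<longleftrightarrow>
     (\<forall>Q. finite Q \<and> Q \<subseteq> \<F> \<longrightarrow> infinite (\<Inter>Q) \<and> (\<forall>A \<in> \<F> - Q. infinite (\<Inter>Q - A)))"

lemma split_infinite:
  fixes B :: "nat set"
  assumes "infinite B"
  obtains C where "C \<subseteq> B" "infinite C" "infinite (B - C)"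
proof -
  let ?e = "enumerate B"
  have inj: "inj ?e" and ran: "range ?e = B"
    using assms by (simp_all add: strict_mono_enumerate strict_mono_imp_inj_on range_enumerate)
  have "infinite (?e ` {n. even n})" "infinite (?e ` {n. odd n})"
  proof -
    have "infinite {n::nat. even n}" "infinite {n::nat. odd n}"
      unfolding infinite_nat_iff_unbounded
      by (metis mem_Collect_eq dvd_triv_left lessI less_Suc_eq not_less_eq even_Suc)+
    then show "infinite (?e ` {n. even n})" "infinite (?e ` {n. odd n})"
      using inj by (metis finite_imageD inj_on_subset subset_UNIV)+
  qed
  moreover have "?e ` {n. odd n} \<subseteq> B - ?e ` {n. even n}" using inj ran by (auto dest: injD)
  ultimately show thesis using that[of "?e ` {n. even n}"] ran by (metis image_mono infinite_super subset_UNIV)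
qed

text \<open>
  A pseudo-intersection \<open>B\<close> leaves room in the family: every mixed intersection is almost disjoint from
  \<open>B\<close> and every pure one almost contains it, so removing half of \<open>B\<close> from the full set yields a new
  member that spoils \<open>B\<close>.
\<close>
lemma strongly_independent_extend:
  assumes F: "strongly_independent \<F>"
    and B: "infinite B" "\<And>A. A \<in> \<F> \<Longrightarrow> finite (B - A)"
    and C: "C \<subseteq> B" "infinite C" "infinite (B - C)"
  shows "strongly_independent (insert (- C) \<F>)"
  unfolding strongly_independent_def
proof (intro allI impI conjI ballI)
  fix Q assume "finite Q \<and> Q \<subseteq> insert (- C) \<F>"
  then have Q: "finite Q" "Q \<subseteq> insert (- C) \<F>" by auto
  define R where "R = Q - {- C}"
  have R: "finite R" "R \<subseteq> \<F>" using Q by (auto simp: R_def)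
  have almost: "finite (B - \<Inter>R)"
  proof -
    have fin: "finite (\<Union>A\<in>R. B - A)" using R by (intro finite_UN_I) (auto intro: B(2))
    show ?thesis by (rule finite_subset[OF _ fin]) blast
  qed
  have Q': "\<Inter>R - C \<subseteq> \<Inter>Q" by (auto simp: R_def)
  have "infinite ((B - C) - (B - \<Inter>R))" "infinite (C - (B - \<Inter>R))"
    using almost C(2,3) by (simp_all add: Diff_infinite_finite)
  moreover have "(B - C) - (B - \<Inter>R) \<subseteq> \<Inter>R - C" "C - (B - \<Inter>R) \<subseteq> \<Inter>R \<inter> C" using C by auto
  ultimately have inf: "infinite (\<Inter>R - C)" "infinite (\<Inter>R \<inter> C)" by (metis finite_subset)+
  show "infinite (\<Inter>Q)" using inf Q' by (auto dest: finite_subset)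
  fix A assume A: "A \<in> insert (- C) \<F> - Q"
  show "infinite (\<Inter>Q - A)"
  proof (cases "A = - C")
    case True
    then have "R = Q" using A by (auto simp: R_def)
    then show ?thesis using inf True by (simp add: Diff_eq)
  next
    case False
    then have "A \<in> \<F> - R" using A by (auto simp: R_def)
    then have "infinite (\<Inter>R - A)" and "finite (B - A)"
      using F R B(2) by (auto simp: strongly_independent_def)
    \<comment> \<open>\<open>\<Inter>R - A\<close> is almost disjoint from \<open>B\<close>, hence from \<open>C\<close>\<close>
    then have "infinite ((\<Inter>R - A) - (B - A))" by (simp add: Diff_infinite_finite)
    moreover have "(\<Inter>R - A) - (B - A) \<subseteq> \<Inter>Q - A" using Q' C by auto
    ultimately show ?thesis by (auto dest: finite_subset)
  qed
qed

text \<open>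
  A maximal strongly independent family works, by the preceding extension step.
\<close>
lemma strongly_independent_no_pseudointersection:
  obtains \<F> where "strongly_independent \<F>" "\<forall>B. infinite B \<longrightarrow> (\<exists>A\<in>\<F>. infinite (B - A))"
proof -
  have "\<exists>M\<in>Collect strongly_independent. \<forall>X\<in>Collect strongly_independent. M \<subseteq> X \<longrightarrow> X = M"
  proof (rule subset_Zorn_nonempty)
    have "strongly_independent {}" by (auto simp: strongly_independent_def)
    then show "Collect strongly_independent \<noteq> {}" by blast
    fix \<C> assume ne: "\<C> \<noteq> {}" and chain: "subset.chain (Collect strongly_independent) \<C>"
    have "infinite (\<Inter>Q) \<and> (\<forall>A \<in> \<Union>\<C> - Q. infinite (\<Inter>Q - A))" if Q: "finite Q" "Q \<subseteq> \<Union>\<C>" for Q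
    proof -
      obtain F where F: "F \<in> \<C>" "Q \<subseteq> F"
        using finite_subset_Union_chain[OF Q ne chain] .
      have "infinite (\<Inter>Q - A)" if A: "A \<in> \<Union>\<C> - Q" for A
      proof -
        obtain F' where F': "F' \<in> \<C>" "insert A Q \<subseteq> F'"
          using finite_subset_Union_chain[OF _ _ ne chain, of "insert A Q"] A Q by blast
        then have "strongly_independent F'" using chain by (auto simp: subset.chain_def)
        then show ?thesis using F' A Q unfolding strongly_independent_def by simp
      qed
      moreover have "strongly_independent F" using F chain by (auto simp: subset.chain_def)
      ultimately show ?thesis using F Q unfolding strongly_independent_def by simp
    qed
    then show "\<Union>\<C> \<in> Collect strongly_independent" by (simp add: strongly_independent_def)
  qed
  then obtain \<F> where F: "strongly_independent \<F>"
    and max: "\<And>X. strongly_independent X \<Longrightarrow> \<F> \<subseteq> X \<Longrightarrow> X = \<F>" by auto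
  show thesis
  proof (rule that[OF F], intro allI impI, rule ccontr)
    fix B :: "nat set" assume B: "infinite B" "\<not> (\<exists>A\<in>\<F>. infinite (B - A))"
    obtain C where C: "C \<subseteq> B" "infinite C" "infinite (B - C)"
      using split_infinite[OF B(1)] .
    have "- C \<in> \<F>"
      using max[OF strongly_independent_extend[OF F B(1) _ C]] B(2) by auto
    moreover have "B - - C = C" using C by auto
    ultimately show False using B(2) C by force
  qed
qed

section \<open>A recurrent array of marks\<close>

text \<open>
  Base 4 leaves a gap between sums of distinct powers: with only the digits 0 and 1 the lower digits
  add up to less than a third of the next power, so a small perturbation cannot propagate upwards.
\<close>
definition base4 :: "nat set \<Rightarrow> nat" where "base4 G = (\<Sum>l\<in>G. 4 ^ l)"

lemma base4_empty [simp]: "base4 {} = 0" by (simp add: base4_def)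

lemma base4_Un: "finite G \<Longrightarrow> finite H \<Longrightarrow> G \<inter> H = {} \<Longrightarrow> base4 (G \<union> H) = base4 G + base4 H"
  by (simp add: base4_def sum.union_disjoint)

lemma base4_ge: "finite G \<Longrightarrow> l \<in> G \<Longrightarrow> 4 ^ l \<le> base4 G"
  unfolding base4_def by (rule member_le_sum) auto

lemma base4_less: "G \<subseteq> {..<n} \<Longrightarrow> 3 * base4 G < 4 ^ n"
proof -
  have "3 * (\<Sum>l<n. 4 ^ l) < (4 ^ n :: nat)" by (induction n) auto
  moreover assume "G \<subseteq> {..<n}"
  then have "base4 G \<le> (\<Sum>l<n. 4 ^ l)" unfolding base4_def by (intro sum_mono2) auto
  ultimately show ?thesis by linarith
qed

lemma base4_split:
  assumes "finite G"
  shows "base4 G = base4 (G \<inter> {..<n}) + base4 (G \<inter> {n..})"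
proof -
  have "G = (G \<inter> {..<n}) \<union> (G \<inter> {n..})" by auto
  moreover have "base4 ((G \<inter> {..<n}) \<union> (G \<inter> {n..})) = base4 (G \<inter> {..<n}) + base4 (G \<inter> {n..})"
    using assms by (intro base4_Un) auto
  ultimately show ?thesis by simp
qed

lemma base4_upper:
  assumes "finite G" "finite G'" "G \<inter> {n..} = G' \<inter> {n..}"
  shows "3 * base4 G < 3 * base4 G' + 4 ^ n"
  using base4_split[OF assms(1), of n] base4_split[OF assms(2), of n] base4_less[of "G \<inter> {..<n}" n] assms(3) by simp

lemma base4_lower:
  assumes "finite G" "finite G'" "G \<inter> {Suc n..} = G' \<inter> {Suc n..}" "n \<in> G" "n \<notin> G'"
  shows "3 * base4 G' + 2 * 4 ^ n < 3 * base4 G"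
proof -
  have "base4 (G - {n}) + 4 ^ n = base4 G"
    using assms(1,4) by (simp add: base4_def sum.remove[of G n])
  moreover have "(G - {n}) \<inter> {n..} = G' \<inter> {n..}"
  proof -
    have "{n..} = insert n {Suc n..}" by auto
    then show ?thesis using assms by auto
  qed
  then have "3 * base4 G' < 3 * base4 (G - {n}) + 4 ^ n"
    using base4_upper[of G' "G - {n}" n] assms(1,2) by simp
  ultimately show ?thesis by linarith
qed

lemma top_difference:
  fixes G G' :: "nat set"
  assumes "finite G" "finite G'" "l \<in> G" "l \<notin> G'"
  obtains n where "l \<le> n" "(n \<in> G) \<noteq> (n \<in> G')" "G \<inter> {Suc n..} = G' \<inter> {Suc n..}"
proof -
  let ?S = "(G - G') \<union> (G' - G)"
  have S: "finite ?S" "l \<in> ?S" using assms by auto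
  have max: "j \<le> Max ?S" if "j \<in> ?S" for j using S that by simp
  have "G \<inter> {Suc (Max ?S)..} = G' \<inter> {Suc (Max ?S)..}"
  proof -
    have "j \<in> G \<longleftrightarrow> j \<in> G'" if "Suc (Max ?S) \<le> j" for j
    proof (rule ccontr)
      assume "\<not> ?thesis"
      then have "j \<in> ?S" by blast
      from max[OF this] that show False by linarith
    qed
    then show ?thesis by blast
  qed
  moreover have "Max ?S \<in> ?S" using S by (metis Max_in empty_iff)
  ultimately show thesis using max[OF S(2)] by (intro that[of "Max ?S"]) auto
qed

text \<open>
  The topmost digit \<open>n\<close> in which the two sets differ separates the sums by more than \<open>2/3 * 4 ^ n\<close>.
\<close>
lemma base4_eq_imp_high_eq:
  assumes G: "finite G" "finite G'" and eq: "int (base4 G) + m = int (base4 G')" and m: "\<bar>m\<bar> \<le> 4 ^ L" and l: "L < l"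
  shows "l \<in> G \<longleftrightarrow> l \<in> G'"
proof (rule ccontr)
  assume "\<not> ?thesis"
  then obtain n where n: "l \<le> n" "(n \<in> G) \<noteq> (n \<in> G')" "G \<inter> {Suc n..} = G' \<inter> {Suc n..}"
    using top_difference[OF G, of l] top_difference[OF G(2,1), of l] by (metis (full_types))
  have "(4::int) ^ Suc L \<le> 4 ^ n" using l n(1) by (intro power_increasing) auto
  then have "4 * \<bar>m\<bar> \<le> 4 ^ n" using m by simp
  moreover have "3 * int (base4 G') + 2 * 4 ^ n < 3 * int (base4 G) \<or> 3 * int (base4 G) + 2 * 4 ^ n < 3 * int (base4 G')"
  proof (cases "n \<in> G")
    case True
    from base4_lower[OF G n(3) True] n(2) True have "3 * base4 G' + 2 * 4 ^ n < 3 * base4 G" by simp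
    then have "int (3 * base4 G' + 2 * 4 ^ n) < int (3 * base4 G)" by (rule of_nat_less_iff[THEN iffD2])
    then show ?thesis by simp
  next
    case False
    from base4_lower[OF G(2,1) n(3)[symmetric]] n(2) False have "3 * base4 G + 2 * 4 ^ n < 3 * base4 G'" by simp
    then have "int (3 * base4 G + 2 * 4 ^ n) < int (3 * base4 G')" by (rule of_nat_less_iff[THEN iffD2])
    then show ?thesis by simp
  qed
  ultimately show False using eq by (simp add: abs_if split: if_splits) 
qed

text \<open>
  If the position \<open>4 ^ l\<close> before a sum is a sum itself, then \<open>l\<close> is a digit. The converse being
  obvious, the marks to the left of a sum reveal its digits.
\<close>
lemma base4_minus_power_mem:
  assumes G: "finite G" "finite G'" and eq: "base4 G = base4 G' + 4 ^ l"
  shows "l \<in> G"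
proof -
  have "G \<noteq> G'" using eq by auto
  then obtain n where n: "(n \<in> G) \<noteq> (n \<in> G')" "G \<inter> {Suc n..} = G' \<inter> {Suc n..}"
    using top_difference[OF G] top_difference[OF G(2,1)] by (metis subsetI subset_antisym)
  have nG: "n \<in> G" "n \<notin> G'"
    using n base4_lower[OF G(2,1) n(2)[symmetric]] eq by auto
  have "2 * 4 ^ n < (3 * 4 ^ l :: nat)" using base4_lower[OF G n(2) nG] eq by simp
  then have "n \<le> l"
    using power_increasing[of "Suc l" n "4::nat"] by (cases "n \<le> l") (auto simp: not_le Suc_le_eq)
  moreover have "\<not> n < l"
  proof
    assume "n < l"
    then have "(4::nat) ^ Suc n \<le> 4 ^ l" by (intro power_increasing) auto
    then show False using base4_upper[OF G n(2)] eq by simp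
  qed
  ultimately show ?thesis using nG by auto
qed

definition shift :: "int \<Rightarrow> ('i \<times> int \<Rightarrow> bool) \<Rightarrow> 'i \<times> int \<Rightarrow> bool" where
  "shift k t = (\<lambda>(i, m). t (i, m + k))"

definition mark :: "nat set set \<Rightarrow> nat set \<times> int \<Rightarrow> bool" where
  "mark \<F> = (\<lambda>(A, k). A \<in> \<F> \<and> (\<exists>G. finite G \<and> G \<subseteq> A \<and> k = int (base4 G)))"

lemma mark_neg: "k < 0 \<Longrightarrow> \<not> mark \<F> (A, k)"
  by (auto simp: mark_def)

lemma mark_zero: "A \<in> \<F> \<Longrightarrow> mark \<F> (A, 0)"
  by (auto simp: mark_def intro!: exI[of _ "{}"])

text \<open>
  The self-similarity of the rows: moved by a sum of large powers, a row either repeats its beginning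
  or vanishes on a long window.
\<close>
lemma mark_add:
  assumes H: "finite H" "\<And>h. h \<in> H \<Longrightarrow> L < h" and m: "\<bar>m\<bar> \<le> 4 ^ L"
  shows "mark \<F> (A, int (base4 H) + m) \<longleftrightarrow> H \<subseteq> A \<and> mark \<F> (A, m)"
proof
  assume "mark \<F> (A, int (base4 H) + m)"
  then obtain G where G: "A \<in> \<F>" "finite G" "G \<subseteq> A" "int (base4 H) + m = int (base4 G)"
    by (auto simp: mark_def)
  have "H \<subseteq> G" using base4_eq_imp_high_eq[OF H(1) G(2,4) m] H(2) by blast
  moreover have "G = H \<union> (G - H)" using \<open>H \<subseteq> G\<close> by auto
  then have "base4 G = base4 H + base4 (G - H)" using base4_Un[of H "G - H"] G(2) H(1) by auto
  ultimately show "H \<subseteq> A \<and> mark \<F> (A, m)"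
    using G by (auto simp: mark_def intro!: exI[of _ "G - H"])
next
  assume *: "H \<subseteq> A \<and> mark \<F> (A, m)"
  then obtain G where G: "A \<in> \<F>" "finite G" "G \<subseteq> A" "m = int (base4 G)"
    by (auto simp: mark_def)
  have "l \<notin> H" if "l \<in> G" for l
  proof
    assume "l \<in> H"
    then have "(4::nat) ^ L < 4 ^ l" using H(2) by (intro power_strict_increasing) auto
    also have "\<dots> \<le> base4 G" using base4_ge G that by blast
    finally have "int (4 ^ L) < int (base4 G)" by (rule of_nat_less_iff[THEN iffD2])
    with m G(4) show False by simp
  qed
  then have "base4 (H \<union> G) = base4 H + base4 G" using H G by (intro base4_Un) auto
  then show "mark \<F> (A, int (base4 H) + m)"
    using * G H by (auto simp: mark_def intro!: exI[of _ "H \<union> G"])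
qed

lemma le_power4: obtains L where "(m::int) \<le> 4 ^ L"
proof -
  have "m \<le> 4 ^ nat m"
  proof (cases "0 \<le> m")
    case True
    have "nat m < 4 ^ nat m" by (rule less_exp[THEN less_le_trans]) (simp add: power_mono)
    then have "int (nat m) < int (4 ^ nat m)" by (rule of_nat_less_iff[THEN iffD2])
    then show ?thesis using True by simp
  qed (simp add: order_trans[of m 0])
  then show thesis by (rule that)
qed

lemma mark_recurrent:
  assumes F: "strongly_independent \<F>" and A: "A \<in> \<F> - Q" and Q: "finite Q"
  obtains s where "M < s" "\<And>q m. q \<in> Q \<Longrightarrow> \<bar>m\<bar> \<le> M \<Longrightarrow> mark \<F> (q, m + s) = mark \<F> (q, m)"
    "\<And>m. \<bar>m\<bar> \<le> M \<Longrightarrow> \<not> mark \<F> (A, m + s)"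
proof -
  obtain L where L: "M \<le> 4 ^ L" using le_power4 .
  have "infinite (\<Inter>(Q \<inter> \<F>) - A)"
    using F A Q unfolding strongly_independent_def by (metis Diff_iff Int_iff finite_Int inf_le2)
  then obtain l where l: "l > L" "l \<in> \<Inter>(Q \<inter> \<F>) - A"
    unfolding infinite_nat_iff_unbounded by blast
  have add: "mark \<F> (B, m + 4 ^ l) \<longleftrightarrow> l \<in> B \<and> mark \<F> (B, m)" if "\<bar>m\<bar> \<le> M" for B m
    using mark_add[of "{l}" L m \<F> B] l that L by (simp add: base4_def add.commute)
  show thesis
  proof (rule that[of "4 ^ l"])
    have "(4::int) ^ L < 4 ^ l" using l by (intro power_strict_increasing) auto
    then show "M < 4 ^ l" using L by linarith
    show "mark \<F> (q, m + 4 ^ l) = mark \<F> (q, m)" if "q \<in> Q" "\<bar>m\<bar> \<le> M" for q m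
    proof (cases "q \<in> \<F>")
      case True then show ?thesis using add that l by auto
    qed (simp add: mark_def)
    show "\<not> mark \<F> (A, m + 4 ^ l)" if "\<bar>m\<bar> \<le> M" for m using add that l by simp
  qed
qed

text \<open>
  Suppose that a limit \<open>t\<close> of shifts has no zero row. The marks of one row \<open>A0\<close> to the left of a position \<open>m0\<close>
  with \<open>t (A0, m0)\<close> determine the low digits of the shifts that approximate \<open>t\<close>; in the limit they form
  a set \<open>B\<close>. Each nonzero row \<open>A\<close> forces almost all digits into \<open>A\<close>, so \<open>B\<close> is almost contained in
  every member of the family and is therefore finite. The digits of the approximating shifts beyond
  \<open>B\<close> tend to infinity and lie in \<open>A\<close> for each fixed row \<open>A\<close>, so they leave no trace in the limit.
\<close>
lemma mark_limit_cases:
  assumes pseudo: "\<And>B. infinite B \<Longrightarrow> \<exists>A\<in>\<F>. infinite (B - A)" 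
    and t: "\<And>J. finite J \<Longrightarrow> \<exists>k. \<forall>j\<in>J. shift k (mark \<F>) j = t j"
    and nz: "\<And>A. A \<in> \<F> \<Longrightarrow> \<exists>m. t (A, m)"
  shows "\<exists>n. t = shift n (mark \<F>)"
proof -
  obtain A0 where A0: "A0 \<in> \<F>" using pseudo[of UNIV] by auto
  obtain m0 where m0: "t (A0, m0)" using nz[OF A0] by auto
  define B where "B = {l. t (A0, m0 - 4 ^ l)}"
  \<comment> \<open>shifts that agree with \<open>t\<close> on a finite set have the digits of \<open>B\<close> as low digits\<close>
  have approx: "\<exists>k G. finite G \<and> k + m0 = int (base4 G) \<and> (\<forall>l\<le>L. l \<in> G \<longleftrightarrow> l \<in> B) \<and> (\<forall>(A, m)\<in>J. t (A, m) = mark \<F> (A, k + m))"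
    if "finite J" for J L
  proof -
    obtain k where k: "\<forall>j \<in> insert (A0, m0) ((\<lambda>l. (A0, m0 - 4 ^ l)) ` {..L} \<union> J). shift k (mark \<F>) j = t j"
      using t[of "insert (A0, m0) ((\<lambda>l. (A0, m0 - 4 ^ l)) ` {..L} \<union> J)"] \<open>finite J\<close> by auto
    have "mark \<F> (A0, m0 + k)" using k m0 by (simp add: shift_def)
    then obtain G where G: "finite G" "G \<subseteq> A0" "m0 + k = int (base4 G)" by (auto simp: mark_def)
    have low: "l \<in> G \<longleftrightarrow> l \<in> B" if "l \<le> L" for l
    proof -
      have "l \<in> B \<longleftrightarrow> mark \<F> (A0, m0 - 4 ^ l + k)"
        using k that by (auto simp: B_def shift_def)
      also have "m0 - 4 ^ l + k = int (base4 G) - 4 ^ l" using G by simp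
      also have "mark \<F> (A0, int (base4 G) - 4 ^ l) \<longleftrightarrow> l \<in> G"
      proof
        assume "mark \<F> (A0, int (base4 G) - 4 ^ l)"
        then obtain G' where "finite G'" "int (base4 G) - 4 ^ l = int (base4 G')" by (auto simp: mark_def)
        then have "finite G'" "int (base4 G) = int (base4 G' + 4 ^ l)" by auto
        then show "l \<in> G" using base4_minus_power_mem[OF G(1)] of_nat_eq_iff by blast
      next
        assume "l \<in> G"
        then have "base4 (G - {l}) + 4 ^ l = base4 G"
          using G(1) by (simp add: base4_def sum.remove[of G l])
        then have "int (base4 G) - 4 ^ l = int (base4 (G - {l}))" by (metis add_diff_cancel_right' of_nat_add of_nat_numeral of_nat_power)
        then show "mark \<F> (A0, int (base4 G) - 4 ^ l)"
          using A0 G unfolding mark_def by (auto intro!: exI[of _ "G - {l}"])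
      qed
      finally show ?thesis by simp
    qed
    have "\<forall>(A, m)\<in>J. t (A, m) = mark \<F> (A, k + m)"
      using k by (auto simp: shift_def add.commute)
    moreover have "k + m0 = int (base4 G)" using G(3) by simp
    ultimately show ?thesis using G(1) low by blast
  qed
  \<comment> \<open>a digit of \<open>B\<close> outside \<open>A\<close> beyond the scale of \<open>m - m0\<close> would contradict the mark \<open>t (A, m)\<close>\<close>
  have "finite (B - A)" if A: "A \<in> \<F>" for A
  proof (rule ccontr)
    assume inf: "infinite (B - A)"
    obtain m where m: "t (A, m)" using nz[OF A] by auto
    obtain L where L: "\<bar>m - m0\<bar> \<le> 4 ^ L" using le_power4 .
    obtain l where l: "L < l" "l \<in> B - A" using inf unfolding infinite_nat_iff_unbounded by blast
    obtain k G where G: "finite G" "k + m0 = int (base4 G)" "\<forall>l'\<le>l. l' \<in> G \<longleftrightarrow> l' \<in> B" "mark \<F> (A, k + m)"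
      using approx[of "{(A, m)}" l] m by auto
    then obtain G' where G': "finite G'" "G' \<subseteq> A" "k + m = int (base4 G')" by (auto simp: mark_def)
    have "int (base4 G) + (m - m0) = int (base4 G')" using G G' by simp
    from base4_eq_imp_high_eq[OF G(1) G'(1) this L l(1)] G(3) l G'(2) show False by auto
  qed
  then have B: "finite B" using pseudo by blast
  have "t (A, m) = shift (int (base4 B) - m0) (mark \<F>) (A, m)" for A m
  proof (cases "A \<in> \<F>")
    case False
    moreover obtain k where "shift k (mark \<F>) (A, m) = t (A, m)" using t[of "{(A, m)}"] by auto
    ultimately show ?thesis by (simp add: shift_def mark_def)
  next
    case True
    obtain m1 where m1: "t (A, m1)" using nz[OF True] by auto
    obtain L1 where L1: "\<bar>int (base4 B) - m0 + m\<bar> \<le> 4 ^ L1" using le_power4 .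
    obtain L2 where L2: "\<bar>int (base4 B) - m0 + m1\<bar> \<le> 4 ^ L2" using le_power4 .
    obtain L3 where L3: "\<forall>l\<in>B. l \<le> L3" using B finite_nat_set_iff_bounded_le by auto
    define L where "L = max L1 (max L2 L3)"
    have pw: "(4::int) ^ L1 \<le> 4 ^ L" "(4::int) ^ L2 \<le> 4 ^ L"
      by (intro power_increasing; simp add: L_def)+
    have L: "\<bar>int (base4 B) - m0 + m\<bar> \<le> 4 ^ L" "\<bar>int (base4 B) - m0 + m1\<bar> \<le> 4 ^ L"
      using order_trans[OF L1 pw(1)] order_trans[OF L2 pw(2)] .
    have BL: "\<forall>l\<in>B. l \<le> L" using L3 by (auto simp: L_def)
    obtain k G where G: "finite G" "k + m0 = int (base4 G)" "\<forall>l\<le>L. l \<in> G \<longleftrightarrow> l \<in> B"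
      "t (A, m) = mark \<F> (A, k + m)" "t (A, m1) = mark \<F> (A, k + m1)"
      using approx[of "{(A, m), (A, m1)}" L] by auto
    define H where "H = G - B"
    have H: "finite H" "\<And>h. h \<in> H \<Longrightarrow> L < h" using G by (auto simp: H_def not_le[symmetric])
    have "G = B \<union> H" using G(3) BL by (auto simp: H_def)
    then have "base4 G = base4 B + base4 H" using base4_Un[OF B H(1)] by (auto simp: H_def)
    then have k: "k + j = int (base4 H) + (int (base4 B) - m0 + j)" for j using G(2) by simp
    have "H \<subseteq> A" using mark_add[OF H L(2), of \<F> A] G(5) m1 k by simp
    then show ?thesis
      using mark_add[OF H L(1), of \<F> A] G(4) k by (simp add: shift_def add.commute)
  qed
  then show ?thesis by (intro exI[of _ "int (base4 B) - m0"]) auto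
qed

section \<open>Spaces of binary arrays\<close>

lemma Hausdorff_space_euclidean_t2: "Hausdorff_space (euclidean :: 'b::t2_space topology)"
  unfolding Hausdorff_space_def disjnt_def by (simp, metis hausdorff)


lemma compact_bool_fun: "compact (UNIV :: ('i \<Rightarrow> bool) set)"
proof -
  have "compact_space (euclidean :: bool topology)" by (simp add: compact_space_def finite_imp_compact)
  then have "compact_space (product_topology (\<lambda>i::'i. euclidean :: bool topology) UNIV)"
    by (simp add: compact_space_product_topology)
  then show ?thesis by (simp add: euclidean_product_topology compact_space_def)
qed
lemma open_cylinder: "finite J \<Longrightarrow> open {x. \<forall>j\<in>J. x j = (t j :: bool)}" for t :: "'i \<Rightarrow> bool"
  using product_topology_basis'[of J "\<lambda>j. {t j}" id] by (simp add: open_discrete)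
lemma open_contains_cylinder: 
  fixes U :: "('i \<Rightarrow> bool) set"
  assumes "open U" "t \<in> U"
  obtains J where "finite J" "{x. \<forall>j\<in>J. x j = t j} \<subseteq> U"
proof -
  from assms obtain X where X: "t \<in> (\<Pi>\<^sub>E i\<in>UNIV. X i)" "finite {i. X i \<noteq> (UNIV::bool set)}" "(\<Pi>\<^sub>E i\<in>UNIV. X i) \<subseteq> U"
    using product_topology_open_contains_basis[of "\<lambda>_. euclidean :: bool topology" UNIV U t]
    by (auto simp: euclidean_product_topology)
  have "x \<in> (\<Pi>\<^sub>E i\<in>UNIV. X i)" if "\<forall>j\<in>{i. X i \<noteq> UNIV}. x j = t j" for x
  proof (rule PiE_I)
    fix i show "x i \<in> X i" using PiE_mem[OF X(1), of i] that by (cases "X i = UNIV") auto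
  qed simp
  with X show thesis by (intro that[of "{i. X i \<noteq> UNIV}"]) auto
qed
lemma closure_bool_fun_iff: "t \<in> closure S \<longleftrightarrow> (\<forall>J. finite J \<longrightarrow> (\<exists>x\<in>S. \<forall>j\<in>J. x j = t j))" for t :: "'i \<Rightarrow> bool"
proof
  assume t: "t \<in> closure S"
  show "\<forall>J. finite J \<longrightarrow> (\<exists>x\<in>S. \<forall>j\<in>J. x j = t j)"
  proof (intro allI impI)
    fix J :: "'i set" assume "finite J"
    from open_cylinder[OF this, of t] have "S \<inter> {x. \<forall>j\<in>J. x j = t j} \<noteq> {}"
      using t unfolding closure_iff_nhds_not_empty by blast
    then show "\<exists>x\<in>S. \<forall>j\<in>J. x j = t j" by auto
  qed
next
  assume *: "\<forall>J. finite J \<longrightarrow> (\<exists>x\<in>S. \<forall>j\<in>J. x j = t j)"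
  show "t \<in> closure S"
    unfolding closure_iff_nhds_not_empty
  proof (intro allI impI)
    fix A V assume "V \<subseteq> A" "open V" "t \<in> V"
    then obtain J where "finite J" "{x. \<forall>j\<in>J. x j = t j} \<subseteq> V"
      using open_contains_cylinder by blast
    then show "S \<inter> A \<noteq> {}" using * \<open>V \<subseteq> A\<close> by blast
  qed
qed
lemma closed_cylinder:
  assumes "finite J" shows "closed {x. \<forall>j\<in>J. x j = (t j :: bool)}"
proof -
  have "closure {x. \<forall>j\<in>J. x j = t j} \<subseteq> {x. \<forall>j\<in>J. x j = t j}"
  proof
    fix y assume "y \<in> closure {x. \<forall>j\<in>J. x j = t j}"
    then have "\<exists>x\<in>{x. \<forall>j\<in>J. x j = t j}. \<forall>j\<in>J. x j = y j" using assms unfolding closure_bool_fun_iff by blast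
    then show "y \<in> {x. \<forall>j\<in>J. x j = t j}" by auto
  qed
  then show ?thesis by (simp add: closure_subset_eq)
qed

lemma Hausdorff_space_euclidean_prod_fun: "Hausdorff_space (euclidean :: ('b::t2_space \<times> ('i \<Rightarrow> real)) topology)"
proof -
  have "Hausdorff_space (prod_topology (euclidean::'b topology) (product_topology (\<lambda>_::'i. euclideanreal) UNIV))"
   by (simp add: Hausdorff_space_prod_topology Hausdorff_space_product_topology Hausdorff_space_euclidean_t2)
  then show ?thesis
   by (simp add: euclidean_product_topology)
qed
lemma compact_imp_closed_prod_fun:
  fixes S :: "('b::t2_space \<times> ('i \<Rightarrow> real)) set"
  assumes "compact S" shows "closed S"
proof -
  have "Hausdorff_space (euclidean :: ('b \<times> ('i \<Rightarrow> real)) topology)" by (rule Hausdorff_space_euclidean_prod_fun)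
  then show ?thesis
    using compactin_imp_closedin[of euclidean S] assms by simp
qed

section \<open>Irreducible continua\<close>

text \<open>
  Zorn's lemma: in a compact Hausdorff space the intersection of a chain of closed connected sets is
  connected, because by compactness a separation of the intersection would separate a member.
\<close>
lemma minimal_connected_superset:
  fixes S :: "'b::t2_space set"
  assumes S: "compact S" "connected S" "F \<subseteq> S" "F \<noteq> {}"
  obtains D where "F \<subseteq> D" "D \<subseteq> S" "compact D" "connected D"
    "\<And>E. \<lbrakk>E \<subseteq> D; closed E; connected E; F \<subseteq> E\<rbrakk> \<Longrightarrow> E = D"
proof -
  define \<A> where "\<A> = uminus ` {D. closed D \<and> connected D \<and> F \<subseteq> D \<and> D \<subseteq> S}"
  have "\<exists>M\<in>\<A>. \<forall>X\<in>\<A>. M \<subseteq> X \<longrightarrow> X = M"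
  proof (rule subset_Zorn_nonempty)
    show "\<A> \<noteq> {}" using S compact_imp_closed[OF S(1)] by (auto simp: \<A>_def)
    fix \<C> assume ne: "\<C> \<noteq> {}" and chain: "subset.chain \<A> \<C>"
    define \<F> where "\<F> = uminus ` \<C>"
    have \<F>: "closed E \<and> connected E \<and> F \<subseteq> E \<and> E \<subseteq> S" if "E \<in> \<F>" for E
      using chain that unfolding \<F>_def \<A>_def subset.chain_def by auto
    have lin: "E \<subseteq> E' \<or> E' \<subseteq> E" if "E \<in> \<F>" "E' \<in> \<F>" for E E'
      using chain that unfolding \<F>_def subset.chain_def by auto
    obtain E0 where E0: "E0 \<in> \<F>" using ne by (auto simp: \<F>_def)
    have "connected (\<Inter>\<F>)"
      unfolding connected_closed
    proof (rule notI, elim exE conjE)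
      fix A B assume AB: "closed A" "closed B" "\<Inter>\<F> \<subseteq> A \<union> B" "A \<inter> B \<inter> \<Inter>\<F> = {}"
        "A \<inter> \<Inter>\<F> \<noteq> {}" "B \<inter> \<Inter>\<F> \<noteq> {}"
      have norm: "normal_space (top_of_set S)"
        using S(1) by (intro compact_Hausdorff_or_regular_imp_normal_space)
          (simp_all add: Hausdorff_space_subtopology Hausdorff_space_euclidean_t2 compact_space_subtopology)
      have clI: "closed (\<Inter>\<F>)" "\<Inter>\<F> \<subseteq> S" using \<F> E0 by auto
      then have "closedin (top_of_set S) (A \<inter> \<Inter>\<F>)" "closedin (top_of_set S) (B \<inter> \<Inter>\<F>)"
        using AB by (auto intro!: closed_subset)
      moreover have "disjnt (A \<inter> \<Inter>\<F>) (B \<inter> \<Inter>\<F>)" using AB by (auto simp: disjnt_def)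
      ultimately obtain U V where "openin (top_of_set S) U" "openin (top_of_set S) V"
          "A \<inter> \<Inter>\<F> \<subseteq> U" "B \<inter> \<Inter>\<F> \<subseteq> V" "disjnt U V"
        using norm unfolding normal_space_def by metis
      then obtain U' V' where UV: "open U'" "open V'" "A \<inter> \<Inter>\<F> \<subseteq> U'" "B \<inter> \<Inter>\<F> \<subseteq> V'"
          "S \<inter> U' \<inter> V' = {}"
        unfolding openin_open disjnt_def by (auto simp: Int_ac)
      \<comment> \<open>by compactness a single member of the chain already lies in the two open sets\<close>
      have "\<exists>E\<in>\<F>. E \<subseteq> U' \<union> V'"
      proof (rule ccontr)
        assume no: "\<not> (\<exists>E\<in>\<F>. E \<subseteq> U' \<union> V')"
        have "(S - (U' \<union> V')) \<inter> \<Inter>\<F> \<noteq> {}"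
        proof (rule compact_imp_fip)
          show "compact (S - (U' \<union> V'))" using S UV by (intro compact_diff) auto
          show "closed T" if "T \<in> \<F>" for T using \<F> that by auto
          fix \<G> assume \<G>: "finite \<G>" "\<G> \<subseteq> \<F>"
          have "\<exists>E\<in>\<F>. E \<subseteq> \<Inter>\<G>" using \<G>
          proof (induction \<G> rule: finite_induct)
            case empty then show ?case using E0 by auto
          next
            case (insert X \<G>)
            then obtain E where "E \<in> \<F>" "E \<subseteq> \<Inter>\<G>" by auto
            with insert.prems lin[of E X] show ?case by auto
          qed
          then obtain E where "E \<in> \<F>" "E \<subseteq> \<Inter>\<G>" by auto
          moreover obtain x where "x \<in> E" "x \<notin> U' \<union> V'" using no \<open>E \<in> \<F>\<close> by auto
          moreover have "x \<in> S" using \<F>[OF \<open>E \<in> \<F>\<close>] \<open>x \<in> E\<close> by auto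
          ultimately have "x \<in> (S - (U' \<union> V')) \<inter> \<Inter>\<G>" by auto
          then show "(S - (U' \<union> V')) \<inter> \<Inter>\<G> \<noteq> {}" by auto
        qed
        moreover have "\<Inter>\<F> \<subseteq> U' \<union> V'" using AB(3) UV(3,4) by blast
        ultimately show False by blast
      qed
      then obtain E where E: "E \<in> \<F>" "E \<subseteq> U' \<union> V'" by auto
      have "connected E" "E \<subseteq> S" using E \<F> by auto
      moreover have "U' \<inter> E \<noteq> {}" "V' \<inter> E \<noteq> {}" using UV(3,4) AB(5,6) E(1) by blast+
      ultimately show False
        using UV(1,2,5) E(2) unfolding connected_def by blast
    qed
    then have "- \<Inter>\<F> \<in> \<A>" unfolding \<A>_def using \<F> E0 by (intro imageI) auto
    moreover have "- \<Inter>\<F> = \<Union>\<C>" by (auto simp: \<F>_def)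
    ultimately show "\<Union>\<C> \<in> \<A>" by simp
  qed
  then obtain M where "M \<in> \<A>" and max: "\<And>X. X \<in> \<A> \<Longrightarrow> M \<subseteq> X \<Longrightarrow> X = M" by blast
  moreover define D where "D = - M"
  ultimately have D: "closed D" "connected D" "F \<subseteq> D" "D \<subseteq> S" and M: "M = - D"
    by (auto simp: \<A>_def)
  show thesis
  proof (rule that[of D])
    show "compact D" using compact_Int_closed[OF S(1) D(1)] D(4) by (simp add: Int_absorb1)
    fix E assume "E \<subseteq> D" "closed E" "connected E" "F \<subseteq> E"
    moreover from this have "- E \<in> \<A>" using D unfolding \<A>_def by blast
    ultimately show "E = D" using max[of "- E"] M by auto
  qed (use D in auto)
qed

text \<open>
  Removing an open set from a continuum that is irreducible between \<open>a\<close> and \<open>b\<close> puts \<open>a\<close> and \<open>b\<close> into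
  different components, and in a compact Hausdorff space components are quasi-components. If one of
  the two points is itself removed, a trivial partition serves.
\<close>
lemma irreducible_separation:
  fixes D :: "'b::t2_space set"
  assumes D: "compact D" "U \<inter> D \<noteq> {}" "open U"
    and min: "\<And>E. \<lbrakk>E \<subseteq> D; closed E; connected E; a \<in> E; b \<in> E\<rbrakk> \<Longrightarrow> E = D"
  obtains P P' where "closed P" "closed P'" "P \<inter> P' = {}" "P \<union> P' = D - U" "a \<notin> P'" "b \<notin> P"
proof -
  define K where "K = D - U"
  have K: "compact K" "closed K" using D compact_diff compact_imp_closed unfolding K_def by blast+
  consider "a \<notin> K" | "b \<notin> K" | "a \<in> K" "b \<in> K" by blast
  then show thesis
  proof cases
    case 1 then show thesis using that[of "{}" K] K K_def by simp
  next
    case 2 then show thesis using that[of K "{}"] K K_def by simp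
  next
    case 3
    let ?X = "top_of_set K"
    have "\<not> connected_component_of ?X a b"
    proof
      assume "connected_component_of ?X a b"
      then obtain T where T: "connected T" "T \<subseteq> K" "a \<in> T" "b \<in> T"
        unfolding connected_component_of_def by (auto simp: connectedin_subtopology)
      have "closure T \<subseteq> K" using T K by (simp add: closure_minimal)
      then have "closure T = D"
        using min[of "closure T"] T connected_imp_connected_closure[of T] closure_subset[of T] by (auto simp: K_def)
      with \<open>closure T \<subseteq> K\<close> D(2) show False by (auto simp: K_def)
    qed
    moreover have "quasi_component_of ?X a = connected_component_of ?X a"
      using K by (intro quasi_eq_connected_component_of)
        (simp add: Hausdorff_space_subtopology Hausdorff_space_euclidean_t2 compact_space_subtopology)
    ultimately have "\<not> quasi_component_of ?X a b" by simp
    then obtain T where T: "closedin ?X T" "openin ?X T" "(a \<in> T) \<noteq> (b \<in> T)"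
      using 3 by (auto simp: quasi_component_of_def)
    have T': "closedin ?X (K - T)" using T(2) by (metis closedin_diff closedin_topspace topspace_euclidean_subtopology openin_closedin_eq)
    have "closed T" "closed (K - T)" "T \<subseteq> K"
      using T(1) T' K(2) closedin_closed_trans closedin_imp_subset by blast+
    then show thesis
      using that[of T "K - T"] that[of "K - T" T] T(3) 3 by (auto simp: K_def)
  qed
qed

section \<open>A two-ended irreducible cell over a continuum\<close>

text \<open>
  A continuum between heights -1 and 1 with one point at each extreme height; the two ends have the
  same first coordinate \<open>p\<close>, so that they can be identified over it. After the ends have been identified, the point \<open>(q, 0)\<close>
  still determines the array over which it lies.
\<close>
locale cell =
  fixes D :: "('b::metric_space \<times> real) set" and p q :: 'b
  assumes compact_D: "compact D" and connected_D: "connected D"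
    and height: "\<And>y s. (y, s) \<in> D \<Longrightarrow> \<bar>s\<bar> \<le> 1"
    and bottom: "\<And>y. (y, -1) \<in> D \<longleftrightarrow> y = p" and top: "\<And>y. (y, 1) \<in> D \<longleftrightarrow> y = p"
    and middle: "(q, 0) \<in> D"
    and irreducible: "\<And>E. \<lbrakk>E \<subseteq> D; closed E; connected E; (p, -1) \<in> E; (p, 1) \<in> E\<rbrakk> \<Longrightarrow> E = D"

definition level :: "nat \<Rightarrow> real" where "level n = 2 / (2 * real n + 1)"

lemma level_Suc_less: "level (Suc n) < level n" and level_pos: "0 < level n"
  by (simp_all add: level_def field_simps)

lemma level_le_iff: "level m \<le> level n \<longleftrightarrow> n \<le> m"
  by (simp add: level_def field_simps)

lemma level_0: "level 0 = 2" and level_1: "level (Suc 0) < 1"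
  by (simp_all add: level_def)

lemma level_tendsto: "level \<longlonglongrightarrow> 0"
proof -
  have "(\<lambda>n. 2 * inverse (real (2 * n + 1))) \<longlonglongrightarrow> 2 * 0"
    by (intro tendsto_mult tendsto_const filterlim_compose[OF lim_inverse_n])
       (auto intro!: filterlim_subseq simp: strict_mono_def simp del: of_nat_Suc of_nat_add of_nat_mult)
  then show ?thesis by (simp add: level_def[abs_def] divide_inverse add.commute)
qed

text \<open>
  Between two consecutive values of \<open>level\<close> only the fibre over the single point \<open>g n\<close> is present,
  whereas the slice at each value \<open>\<plusminus>level n\<close> not above 1, and the slice at height 0, are full copies of
  the base set. A connected set that reaches from the bottom to the top has to run through all the
  fibres. The values start at 2, so that heights \<open>\<plusminus>1\<close> lie inside the outermost fibre.
\<close>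
definition comb :: "'b set \<Rightarrow> (nat \<Rightarrow> 'b) \<Rightarrow> ('b \<times> real) set" where
  "comb Y g = {(y, s). y \<in> Y \<and> \<bar>s\<bar> \<le> 1 \<and> (\<forall>n. level (Suc n) < \<bar>s\<bar> \<and> \<bar>s\<bar> < level n \<longrightarrow> y = g n)}"

lemma closed_comb:
  fixes Y :: "'b::t2_space set"
  assumes "closed Y"
  shows "closed (comb Y g)"
proof -
  have "comb Y g = (Y \<times> {-1..1}) \<inter>
     (\<Inter>n. - ((- {g n}) \<times> ({level (Suc n)<..<level n} \<union> {- level n<..<- level (Suc n)})))"
    using level_pos by (auto simp: comb_def abs_if) (smt (verit))+
  moreover have "closed \<dots>"
    using assms by (intro closed_Int closed_Times closed_INT ballI closed_Compl open_Times open_Un) auto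
  ultimately show ?thesis by simp
qed

lemma connected_comb:
  fixes Y :: "'b::t2_space set"
  assumes "connected Y" "range g \<subseteq> Y"
  shows "connected (comb Y g)"
proof -
  define R where "R n = {(y, s) \<in> comb Y g. level n \<le> s}" for n
  define P where "P n = {g n} \<times> {level (Suc n)..min (level n) 1} \<union> Y \<times> {level (Suc n)}" for n
  have gY: "g n \<in> Y" for n using assms(2) by auto
  have lvl: "(y, level (Suc n)) \<in> comb Y g" if "y \<in> Y" for y n
  proof -
    have "level (Suc n) \<le> 1" using level_le_iff[of "Suc n" "Suc 0"] level_1 by auto
    moreover have "\<not> (level (Suc m) < level (Suc n) \<and> level (Suc n) < level m)" for m
      using level_le_iff[of "Suc n" "Suc m"] level_le_iff[of m "Suc n"] by linarith
    ultimately show ?thesis using that level_pos[of "Suc n"] by (auto simp: comb_def)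
  qed
  have level_le1: "level (Suc n) \<le> 1" for n
    using level_le_iff[of "Suc n" "Suc 0"] level_1 by auto
  have connP: "connected (P n)" for n
  proof -
    have "connected ({g n} \<times> {level (Suc n)..min (level n) 1})"
      by (intro connected_Times) auto
    moreover have "connected (Y \<times> {level (Suc n)})"
      using assms(1) by (intro connected_Times) auto
    moreover have "(g n, level (Suc n)) \<in> {g n} \<times> {level (Suc n)..min (level n) 1} \<inter> Y \<times> {level (Suc n)}"
      using gY level_Suc_less[of n] level_le1[of n] by auto
    ultimately show ?thesis unfolding P_def by (metis connected_Un empty_iff)
  qed
  have PR: "R (Suc n) = R n \<union> P n" for n
  proof
    show "R (Suc n) \<subseteq> R n \<union> P n"
    proof
      fix q assume "q \<in> R (Suc n)"
      then obtain y s where q: "q = (y, s)" "(y, s) \<in> comb Y g" "level (Suc n) \<le> s"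
        by (auto simp: R_def)
      then consider "level n \<le> s" | "s = level (Suc n)" | "level (Suc n) < s" "s < level n" by linarith
      then show "q \<in> R n \<union> P n"
      proof cases
        case 1 then show ?thesis using q by (auto simp: R_def)
      next
        case 2 then show ?thesis using q by (auto simp: P_def comb_def)
      next
        case 3
        then have "\<bar>s\<bar> = s" using level_pos[of "Suc n"] by linarith
        then have "y = g n" "s \<le> 1" using q(2) 3 by (auto simp: comb_def)
        then show ?thesis using q 3 by (auto simp: P_def)
      qed
    qed
    show "R n \<union> P n \<subseteq> R (Suc n)"
    proof
      fix q assume "q \<in> R n \<union> P n"
      then consider "q \<in> R n" | y where "q = (y, level (Suc n))" "y \<in> Y" 
        | s where "q = (g n, s)" "level (Suc n) \<le> s" "s \<le> level n" "s \<le> 1"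
        by (auto simp: P_def)
      then show "q \<in> R (Suc n)"
      proof cases
        case 1 then show ?thesis using level_Suc_less[of n] by (auto simp: R_def)
      next
        case 2 then show ?thesis using lvl by (auto simp: R_def)
      next
        case 3
        have "m = n" if "level (Suc m) < s" "s < level m" for m
          using level_le_iff[of n "Suc m"] level_le_iff[of m "Suc n"] that 3 by linarith
        then have "(g n, s) \<in> comb Y g"
          using 3 gY level_pos[of "Suc n"] by (auto simp: comb_def)
        then show ?thesis using 3 by (auto simp: R_def)
      qed
    qed
  qed
  have R0: "R 0 = {}" by (auto simp: R_def comb_def level_0)
  have connR: "connected (R n)" for n
  proof (induction n)
    case 0 then show ?case by (simp add: R0)
  next
    case (Suc n)
    show ?case
    proof (cases n)
      case 0 then show ?thesis using connP[of 0] by (simp add: PR R0)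
    next
      case (Suc k)
      have "(g n, level n) \<in> R n" using lvl[OF gY] Suc by (auto simp: R_def)
      moreover have "(g n, level n) \<in> P n"
        using level_Suc_less[of n] level_le1[of k] Suc by (auto simp: P_def)
      ultimately show ?thesis using Suc.IH connP unfolding PR by (intro connected_Un) auto
    qed
  qed
  have in1: "(g 0, 1) \<in> R (Suc n)" for n
  proof -
    have "(g 0, 1) \<in> P 0" using level_1 by (simp add: P_def level_0)
    then have "(g 0, 1) \<in> R (Suc 0)" using PR by auto
    then show ?thesis using level_le_iff[of "Suc n" "Suc 0"] by (auto simp: R_def)
  qed
  define U where "U = (\<Union>n. R (Suc n))"
  have connU: "connected U"
    unfolding U_def using in1 connR by (intro connected_Union) blast+
  have cl: "(y, 0) \<in> closure U" if "y \<in> Y" for y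
  proof -
    have "(\<lambda>n. (y, level (Suc n))) \<longlonglongrightarrow> (y, 0)"
      using level_tendsto by (intro tendsto_Pair tendsto_const) (rule LIMSEQ_Suc)
    moreover have "(y, level (Suc n)) \<in> closure U" for n
    proof -
      have "(y, level (Suc n)) \<in> R (Suc n)" using lvl[OF that] by (simp add: R_def)
      then show ?thesis using closure_subset[of U] unfolding U_def by blast
    qed
    ultimately show ?thesis by (intro Lim_in_closed_set[OF closed_closure]) auto
  qed
  define U0 where "U0 = U \<union> Y \<times> {0}"
  have connU0: "connected U0"
    unfolding U0_def by (rule connected_intermediate_closure[OF connU]) (use cl closure_subset in auto)
  have U0: "U0 = {(y, s) \<in> comb Y g. 0 \<le> s}"
  proof -
    have "\<exists>n. level (Suc n) \<le> s" if "0 < s" for s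
    proof -
      have "eventually (\<lambda>n. level (Suc n) < s) sequentially"
        using LIMSEQ_Suc[OF level_tendsto] that by (rule order_tendstoD(2))
      then obtain N where "\<forall>n\<ge>N. level (Suc n) < s" unfolding eventually_sequentially ..
      then have "level (Suc N) < s" by simp
      then show ?thesis by (intro exI[of _ N]) simp
    qed
    moreover have "(y, 0) \<in> comb Y g" if "y \<in> Y" for y
      using that level_pos by (auto simp: comb_def) (smt (verit))
    moreover have "0 \<le> s" if "level n \<le> s" for n s using that level_pos[of n] by linarith
    ultimately show ?thesis
      unfolding U0_def U_def R_def by (auto simp: comb_def) (metis less_eq_real_def)+
  qed
  have "connected ((\<lambda>(y, s). (y, - s)) ` U0)"
    by (intro connected_continuous_image connU0) (auto simp: split_def intro!: continuous_intros)
  moreover have "(\<lambda>(y, s). (y, - s)) ` U0 = {(y, s) \<in> comb Y g. s \<le> 0}"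
  proof -
    have sym: "(y, - s) \<in> comb Y g \<longleftrightarrow> (y, s) \<in> comb Y g" for y s by (simp add: comb_def)
    show ?thesis
    proof (intro set_eqI iffI)
      fix x assume "x \<in> (\<lambda>(y, s). (y, - s)) ` U0"
      then show "x \<in> {(y, s) \<in> comb Y g. s \<le> 0}" unfolding U0 using sym by auto
    next
      fix x assume "x \<in> {(y, s) \<in> comb Y g. s \<le> 0}"
      then have "(fst x, - snd x) \<in> U0" unfolding U0 using sym by auto
      then show "x \<in> (\<lambda>(y, s). (y, - s)) ` U0" by (rule rev_image_eqI) simp
    qed
  qed
  moreover have "(g 0, 0) \<in> U0" by (auto simp: U0_def gY)
  then have "{(y, s) \<in> comb Y g. s \<le> 0} \<inter> U0 \<noteq> {}" unfolding U0 by auto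
  ultimately have "connected ({(y, s) \<in> comb Y g. s \<le> 0} \<union> U0)"
    using connU0 by (intro connected_Un) auto
  moreover have "{(y, s) \<in> comb Y g. s \<le> 0} \<union> U0 = comb Y g" unfolding U0 by auto
  ultimately show ?thesis by simp
qed

lemma comb_ends: 
  assumes "range g \<subseteq> Y" "\<bar>s\<bar> = 1"
  shows "(y, s) \<in> comb Y g \<longleftrightarrow> y = g 0"
proof -
  have "n = 0" if "level (Suc n) < 1" "1 < level n" for n
  proof (rule ccontr)
    assume "n \<noteq> 0"
    then have "level n \<le> level (Suc 0)" by (simp add: level_le_iff)
    with that level_1 show False by linarith
  qed
  then show ?thesis using assms level_1 level_0 by (auto simp: comb_def)
qed

text \<open>
  A connected set that joins the two ends contains points \<open>(g n, h n)\<close> with \<open>h n\<close> tending to 0; as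
  every tail of \<open>g\<close> is dense, these accumulate at the whole middle slice. Hence shrinking the comb to
  a continuum that is irreducible between its ends does not lose the copy of the base set.
\<close>
lemma subcontinuum_comb_contains_middle:
  fixes Y :: "'b::metric_space set"
  assumes "closed E" "connected E" "E \<subseteq> comb Y g" "(p, -1) \<in> E" "(q, 1) \<in> E"
    and dense: "\<And>n. Y \<subseteq> closure (g ` {n..})"
  shows "Y \<times> {0} \<subseteq> E"
proof -
  \<comment> \<open>a height strictly inside the fibre over \<open>g n\<close>\<close>
  define h where "h n = (level (Suc n) + level n) / 2" for n
  have h: "level (Suc n) < h n" "h n < level n" for n
    using level_Suc_less[of n] by (simp_all add: h_def)
  have h_tendsto: "h \<longlonglongrightarrow> 0"
    unfolding h_def using tendsto_divide[OF tendsto_add[OF LIMSEQ_Suc[OF level_tendsto] level_tendsto] tendsto_const, of 2] by simp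
  have conn: "connected (snd ` E)"
    by (intro connected_continuous_image assms continuous_intros)
  have gh: "(g n, h n) \<in> E" if "n \<ge> 1" for n
  proof -
    have "h n \<in> {-1..1}" using h[of n] level_pos[of "Suc n"] level_le_iff[of n 1] level_1 that by auto
    then have "h n \<in> snd ` E"
      using connectedD_interval[OF conn, of "-1" 1 "h n"] assms(4,5) by force
    then obtain y where y: "(y, h n) \<in> E" by auto
    have "\<bar>h n\<bar> = h n" using h[of n] level_pos[of "Suc n"] by linarith
    with y h[of n] assms(3) have "y = g n" by (fastforce simp: comb_def)
    with y show ?thesis by simp
  qed
  show ?thesis
  proof clarify
    fix y assume y: "y \<in> Y"
    show "(y, 0) \<in> E"
    proof (rule ccontr)
      assume "(y, 0) \<notin> E"
      then obtain e where e: "e > 0" "\<And>x. x \<in> E \<Longrightarrow> e \<le> dist x (y, 0)"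
        using assms(1) closed_approachable[of E "(y, 0)"] by (meson not_le)
      have "eventually (\<lambda>n. h n < e / 2) sequentially"
        using h_tendsto e(1) by (intro order_tendstoD(2)) auto
      then obtain N where N: "\<And>n. n \<ge> N \<Longrightarrow> h n < e / 2" by (auto simp: eventually_sequentially)
      have "y \<in> closure (g ` {max N 1..})" using dense y by blast
      then obtain n where n: "n \<ge> N" "n \<ge> 1" "dist (g n) y < e / 2"
        using e(1) unfolding closure_approachable by (metis (no_types, lifting) atLeast_iff half_gt_zero image_iff max.bounded_iff)
      have "dist (g n, h n) (y, 0) \<le> dist (g n) y + dist (h n) 0"
        using sqrt_sum_squares_le_sum_abs[of "dist (g n) y" "h n"] by (simp add: dist_Pair_Pair)
      also have "\<dots> < e"
        using n N[of n] h[of n] level_pos[of "Suc n"] by (auto simp: dist_real_def)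
      finally show False using e(2)[OF gh] n by fastforce
    qed
  qed
qed


lemma cell_exists:
  fixes Y :: "'b::metric_space set" and g :: "nat \<Rightarrow> 'b"
  assumes Y: "compact Y" "connected Y" "range g \<subseteq> Y" "\<And>n. Y \<subseteq> closure (g ` {n..})"
  obtains D where "cell D (g 0) (g 0)" "D \<subseteq> Y \<times> {-1..1}" "Y \<times> {0} \<subseteq> D"
proof -
  have sub: "comb Y g \<subseteq> Y \<times> {-1..1}" by (auto simp: comb_def)
  have "comb Y g = (Y \<times> {-1..1}) \<inter> comb Y g" using sub by auto
  also have "compact \<dots>"
    using Y(1) closed_comb[OF compact_imp_closed[OF Y(1)]] by (intro compact_Int_closed compact_Times) auto
  finally have "compact (comb Y g)" .
  moreover have "connected (comb Y g)" using connected_comb Y by blast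
  moreover have "{(g 0, -1), (g 0, 1)} \<subseteq> comb Y g" using comb_ends[OF Y(3)] by simp
  ultimately obtain D where D: "{(g 0, -1), (g 0, 1)} \<subseteq> D" "D \<subseteq> comb Y g" "compact D" "connected D"
    and min: "\<And>E. \<lbrakk>E \<subseteq> D; closed E; connected E; {(g 0, -1), (g 0, 1)} \<subseteq> E\<rbrakk> \<Longrightarrow> E = D"
    by (rule minimal_connected_superset) (simp, metis)
  show thesis
  proof (rule that)
    show mid: "Y \<times> {0} \<subseteq> D"
      using subcontinuum_comb_contains_middle[of D Y g "g 0" "g 0"] D Y(4) compact_imp_closed by auto
    show DY: "D \<subseteq> Y \<times> {-1..1}" using D(2) sub by blast
    show "cell D (g 0) (g 0)"
    proof
      show "compact D" "connected D" by (fact D(3), fact D(4))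
      show "\<bar>s\<bar> \<le> 1" if "(y, s) \<in> D" for y s
      proof -
        have "s \<in> {-1..1}" using DY that by blast
        then show ?thesis by auto
      qed
      show "(y, -1) \<in> D \<longleftrightarrow> y = g 0" "(y, 1) \<in> D \<longleftrightarrow> y = g 0" for y
        using D(1,2) comb_ends[OF Y(3), of "-1" y] comb_ends[OF Y(3), of 1 y] by auto
      show "(g 0, 0) \<in> D" using mid Y(3) by blast
      show "E = D" if "E \<subseteq> D" "closed E" "connected E" "(g 0, -1) \<in> E" "(g 0, 1) \<in> E" for E
        using min that by auto
    qed
  qed
qed

section \<open>Suspending the shift over a cell\<close>

lemma shift_shift [simp]: "shift a (shift b t) = shift (a + b) t"
  by (auto simp: shift_def fun_eq_iff add.assoc)

lemma shift_0 [simp]: "shift 0 t = t"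
  by (auto simp: shift_def fun_eq_iff)

lemma shift_apply: "shift k t (i, m) = t (i, m + k)"
  by (simp add: shift_def)

lemma continuous_shift: "continuous_on UNIV (shift k)"
  unfolding shift_def split_def by (intro continuous_on_coordinatewise_then_product) simp

definition orbit :: "int set \<Rightarrow> ('i \<times> int \<Rightarrow> bool) \<Rightarrow> ('i \<times> int \<Rightarrow> bool) set" where
  "orbit S t = (\<lambda>k. shift k t) ` S"

definition erase :: "'i \<Rightarrow> ('i \<times> int \<Rightarrow> bool) \<Rightarrow> 'i \<times> int \<Rightarrow> bool" where
  "erase i t = (\<lambda>(j, m). j \<noteq> i \<and> t (j, m))"

text \<open>
  The real coordinates of the suspension. The coordinates \<open>1 - s\<^sup>2\<close> and \<open>s * (1 - s\<^sup>2)\<close> determine the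
  height \<open>s\<close> but agree at \<open>s = 1\<close> and \<open>s = -1\<close>; the weights \<open>1 - s\<close> and \<open>1 + s\<close> blend an array with its
  shift, and the weight \<open>1 - s\<^sup>2\<close> shows the array itself except at the ends. Thus the array at
  height 1 and its shift at height -1 are identified and nothing else is. Realising the
  quotient inside a product with lines makes it Hausdorff at once.
\<close>
definition profile :: "('i \<times> int \<Rightarrow> bool) \<Rightarrow> real \<Rightarrow> ('i \<times> int) option \<times> bool \<Rightarrow> real" where
  "profile t s = (\<lambda>(j, b). case j of
      None \<Rightarrow> (if b then s * (1 - s\<^sup>2) else 1 - s\<^sup>2)
    | Some (i, m) \<Rightarrow> (if b then (1 - s\<^sup>2) * of_bool (t (i, m))
                      else (1 - s) * of_bool (t (i, m)) + (1 + s) * of_bool (t (i, m + 1))))"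

definition glue :: "('i \<times> int \<Rightarrow> bool) \<times> ('b \<times> real) \<Rightarrow> 'b \<times> (('i \<times> int) option \<times> bool \<Rightarrow> real)" where
  "glue = (\<lambda>(t, (y, s)). (y, profile t s))"

lemma profile_end: "profile t 1 = profile (shift 1 t) (- 1)"
  by (auto simp: profile_def shift_def fun_eq_iff split: option.split)

lemma profile_eqD:
  assumes "profile t s = profile t' s'" "\<bar>s\<bar> \<le> 1" "\<bar>s'\<bar> \<le> 1"
  shows "s = s' \<and> t = t' \<or> s = 1 \<and> s' = -1 \<and> t' = shift 1 t \<or> s = -1 \<and> s' = 1 \<and> t = shift 1 t'"
proof -
  have c: "1 - s\<^sup>2 = 1 - s'\<^sup>2" "s * (1 - s\<^sup>2) = s' * (1 - s'\<^sup>2)"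
    using fun_cong[OF assms(1), of "(None, False)"] fun_cong[OF assms(1), of "(None, True)"]
    by (simp_all add: profile_def)
  have f: "(1 - s) * of_bool (t (i, m)) + (1 + s) * of_bool (t (i, m + 1))
       = (1 - s') * of_bool (t' (i, m)) + (1 + s') * of_bool (t' (i, m + 1))" for i m
    using fun_cong[OF assms(1), of "(Some (i, m), False)"] by (simp add: profile_def)
  have g: "(1 - s\<^sup>2) * of_bool (t (i, m)) = (1 - s'\<^sup>2) * of_bool (t' (i, m))" for i m
    using fun_cong[OF assms(1), of "(Some (i, m), True)"] by (simp add: profile_def)
  show ?thesis
  proof (cases "s\<^sup>2 = 1")
    case False
    then have "s = s'" using c by auto
    moreover have "t = t'"
    proof
      fix j :: "'a \<times> int" obtain i m where "j = (i, m)" by fastforce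
      then show "t j = t' j" using g[of i m] c(1) False by (auto split: if_splits)
    qed
    ultimately show ?thesis by simp
  next
    case True
    then have "s = 1 \<or> s = -1" "s' = 1 \<or> s' = -1" using c(1) by (auto simp: power2_eq_1_iff)
    then consider "s = 1" "s' = 1" | "s = -1" "s' = -1" | "s = 1" "s' = -1" | "s = -1" "s' = 1" by blast
    then show ?thesis
    proof cases
      case 1
      have "t j = t' j" for j using f[of "fst j" "snd j - 1"] 1 by (cases j) (auto split: if_splits)
      then show ?thesis using 1 by auto
    next
      case 2
      have "t j = t' j" for j using f[of "fst j" "snd j"] 2 by (cases j) (auto split: if_splits)
      then show ?thesis using 2 by auto
    next
      case 3
      have "t' j = shift 1 t j" for j using f[of "fst j" "snd j"] 3 by (cases j) (auto simp: shift_def split: if_splits)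
      then show ?thesis using 3 by auto
    next
      case 4
      have "t j = shift 1 t' j" for j using f[of "fst j" "snd j"] 4 by (cases j) (auto simp: shift_def split: if_splits)
      then show ?thesis using 4 by auto
    qed
  qed
qed

lemma continuous_glue: "continuous_on UNIV (glue :: ('i \<times> int \<Rightarrow> bool) \<times> ('b::topological_space \<times> real) \<Rightarrow> _)"
proof -
  have b: "continuous_on UNIV (\<lambda>x :: ('i \<times> int \<Rightarrow> bool) \<times> ('b \<times> real). of_bool (fst x j) :: real)" for j
  proof (rule continuous_on_compose2[of UNIV "of_bool" _ "\<lambda>x. fst x j"])
    show "continuous_on UNIV (of_bool :: bool \<Rightarrow> real)" by (simp add: continuous_on_discrete)
    show "continuous_on UNIV (\<lambda>x :: ('i \<times> int \<Rightarrow> bool) \<times> ('b \<times> real). fst x j)"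
      by (rule continuous_on_product_then_coordinatewise) (intro continuous_intros)
  qed simp
  have "continuous_on UNIV (\<lambda>x :: ('i \<times> int \<Rightarrow> bool) \<times> ('b \<times> real). profile (fst x) (snd (snd x)) q)" for q
  proof -
    obtain j e where q: "q = (j, e)" by fastforce
    show ?thesis
      by (cases j; cases e) (auto simp: q profile_def split_def intro!: continuous_intros b)
  qed
  then have "continuous_on UNIV (\<lambda>x :: ('i \<times> int \<Rightarrow> bool) \<times> ('b \<times> real). (fst (snd x), profile (fst x) (snd (snd x))))"
    by (intro continuous_on_Pair continuous_on_coordinatewise_then_product continuous_intros)
  then show ?thesis by (simp add: glue_def split_def)
qed

lemma continuous_glue': "continuous_on S glue"
  using continuous_glue continuous_on_subset by blast

lemma finite_int_bound:
  assumes "finite (J :: ('i \<times> int) set)"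
  obtains M where "0 \<le> M" "\<And>i m. (i, m) \<in> J \<Longrightarrow> \<bar>m\<bar> \<le> M"
proof -
  have fin: "finite (insert 0 ((\<lambda>(i, m). \<bar>m\<bar>) ` J))" (is "finite ?S") using assms by auto
  show thesis
    by (rule that[of "Max ?S"]) (use fin in \<open>force intro!: Max_ge\<close>)+
qed

context cell
begin

definition suspension :: "('i \<times> int \<Rightarrow> bool) set \<Rightarrow> ('b \<times> (('i \<times> int) option \<times> bool \<Rightarrow> real)) set" where
  "suspension T = glue ` (T \<times> D)"

lemma glue_ends: "glue (t, (p, 1)) = glue (shift 1 t, (p, -1))"
  by (simp add: glue_def profile_end)

lemma glue_eqD:
  assumes "glue (t, d) = glue (t', d')" "d \<in> D" "d' \<in> D"
  shows "d = d' \<and> t = t' \<or> d = (p, 1) \<and> d' = (p, -1) \<and> t' = shift 1 t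
     \<or> d = (p, -1) \<and> d' = (p, 1) \<and> t = shift 1 t'"
proof -
  obtain y s y' s' where d: "d = (y, s)" "d' = (y', s')" by fastforce
  have "y = y'" "profile t s = profile t' s'" using assms(1) by (simp_all add: glue_def d)
  moreover have "\<bar>s\<bar> \<le> 1" "\<bar>s'\<bar> \<le> 1" using height assms d by auto
  ultimately show ?thesis
    using profile_eqD[of t s t' s'] assms(2,3) bottom top by (auto simp: d)
qed

lemma compact_suspension: "closed T \<Longrightarrow> compact (suspension T)"
  unfolding suspension_def
  by (intro compact_continuous_image continuous_glue' compact_Times compact_D)
    (use compact_bool_fun compact_Int_closed[OF compact_bool_fun] in auto)

lemma glue_cell_connected: "connected (suspension {t})"
  unfolding suspension_def by (intro connected_continuous_image continuous_glue' connected_Times connected_D) auto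

lemma suspension_mono: "S \<subseteq> T \<Longrightarrow> suspension S \<subseteq> suspension T"
  by (auto simp: suspension_def)

text \<open>
  Consecutive cells of an orbit share an end point, so any integer interval of an orbit has a
  connected suspension, and the closure of the orbit adds only limit points.
\<close>
lemma connected_suspension_orbit:
  assumes S: "\<And>a b. a \<in> S \<Longrightarrow> b \<in> S \<Longrightarrow> {a..b} \<subseteq> S"
  shows "connected (suspension (closure (orbit S t)))"
proof (cases "S = {}")
  case True then show ?thesis by (simp add: orbit_def suspension_def)
next
  case False
  then obtain c where c: "c \<in> S" by auto
  have seg: "connected (suspension (orbit {a..b} t))" if "a \<le> b" for a b using that
  proof (induction b rule: int_ge_induct)
    case base then show ?case using glue_cell_connected[of "shift a t"] by (simp add: orbit_def)
  next
    case (step b)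
    have "{a..b + 1} = insert (b + 1) {a..b}" using step(1) by auto
    then have "suspension (orbit {a..b + 1} t) = suspension (orbit {a..b} t) \<union> suspension {shift (b + 1) t}"
      by (auto simp: orbit_def suspension_def)
    moreover have "glue (shift b t, (p, 1)) \<in> suspension (orbit {a..b} t)"
      unfolding suspension_def orbit_def using step(1) top by (intro imageI) auto
    moreover have "glue (shift b t, (p, 1)) \<in> suspension {shift (b + 1) t}"
      unfolding suspension_def glue_ends using bottom by (intro imageI) (auto simp: add.commute)
    ultimately show ?case using step.IH glue_cell_connected by (metis IntI connected_Un empty_iff)
  qed
  define \<S> where "\<S> = {suspension (orbit {a..b} t) | a b. a \<in> S \<and> b \<in> S \<and> a \<le> c \<and> c \<le> b}"
  have union: "\<Union>\<S> = suspension (orbit S t)"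
  proof
    show "\<Union>\<S> \<subseteq> suspension (orbit S t)"
    proof
      fix z assume "z \<in> \<Union>\<S>"
      then obtain a b where ab: "a \<in> S" "b \<in> S" "z \<in> suspension (orbit {a..b} t)" by (auto simp: \<S>_def)
      then have "orbit {a..b} t \<subseteq> orbit S t" using S by (auto simp: orbit_def)
      then show "z \<in> suspension (orbit S t)" using ab suspension_mono by blast
    qed
    show "suspension (orbit S t) \<subseteq> \<Union>\<S>"
    proof
      fix z assume "z \<in> suspension (orbit S t)"
      then obtain k where k: "k \<in> S" "z \<in> suspension {shift k t}" by (auto simp: suspension_def orbit_def)
      then have "z \<in> suspension (orbit {min k c..max k c} t)" by (auto simp: suspension_def orbit_def)
      moreover have "min k c \<in> S" "max k c \<in> S" using k c by (auto simp: min_def max_def)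
      ultimately show "z \<in> \<Union>\<S>" unfolding \<S>_def by fastforce
    qed
  qed
  have "glue (shift c t, (p, 1)) \<in> \<Inter>\<S>"
    using top by (auto simp: \<S>_def suspension_def orbit_def)
  then have "\<Inter>\<S> \<noteq> {}" by blast
  moreover have "connected X" if "X \<in> \<S>" for X using that seg by (force simp: \<S>_def)
  ultimately have "connected (\<Union>\<S>)" by (intro connected_Union) auto
  with union have conn: "connected (suspension (orbit S t))" by simp
  show ?thesis
  proof (rule connected_intermediate_closure[OF conn])
    show "suspension (orbit S t) \<subseteq> suspension (closure (orbit S t))" by (intro suspension_mono closure_subset)
    have "suspension (closure (orbit S t)) = glue ` closure (orbit S t \<times> D)"
      using closure_closed[OF compact_imp_closed[OF compact_D]] by (simp add: suspension_def closure_Times)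
    also have "\<dots> \<subseteq> closure (suspension (orbit S t))"
      unfolding suspension_def by (intro image_closure_subset continuous_glue') (auto intro: closure_subset[THEN subsetD])
    finally show "suspension (closure (orbit S t)) \<subseteq> closure (suspension (orbit S t))" .
  qed
qed

lemma two_points_suspension:
  assumes "t \<in> T"
  shows "\<exists>x\<in>suspension T. \<exists>y\<in>suspension T. x \<noteq> y"
proof -
  have "glue (t, (q, 0)) \<noteq> glue (t, (p, 1))" using glue_eqD[OF _ middle, of t t "(p, 1)"] top by auto
  moreover have "glue (t, (q, 0)) \<in> suspension T" "glue (t, (p, 1)) \<in> suspension T"
    using assms middle top by (auto simp: suspension_def)
  ultimately show ?thesis by blast
qed

end

text \<open>
  The properties of the array of marks on which the topology of the suspension depends: \<open>recurrent\<close>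
  makes finitely many rows repeat while another one vanishes, and \<open>limit_cases\<close> describes the points
  of the orbit closure.
\<close>
locale marked_cell = cell D p q
  for D :: "('b::metric_space \<times> real) set" and p q :: 'b +
  fixes u :: "'i \<times> int \<Rightarrow> bool" and I :: "'i set"
  assumes infinite_I: "infinite I"
    and u_neg: "\<And>i k. k < 0 \<Longrightarrow> \<not> u (i, k)" and u_zero: "\<And>i. i \<in> I \<Longrightarrow> u (i, 0)"
    and recurrent: "\<And>i Q M. finite Q \<Longrightarrow> i \<in> I - Q \<Longrightarrow>
       \<exists>s>M. (\<forall>j\<in>Q. \<forall>m. \<bar>m\<bar> \<le> M \<longrightarrow> u (j, m + s) = u (j, m)) \<and> (\<forall>m. \<bar>m\<bar> \<le> M \<longrightarrow> \<not> u (i, m + s))"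
    and limit_cases: "\<And>t. t \<in> closure (orbit UNIV u) \<Longrightarrow>
       (\<exists>i\<in>I. \<forall>m. \<not> t (i, m)) \<or> (\<exists>n. t = shift n u)"
begin

definition T where "T = closure (orbit UNIV u)"
definition "Z = suspension T"

lemma closed_T: "closed T" by (simp add: T_def)

lemma shift_T: "shift k u \<in> T"
  unfolding T_def orbit_def by (rule closure_subset[THEN subsetD]) auto

lemma u_T: "u \<in> T" using shift_T[of 0] by simp

lemma compact_Z: "compact Z" unfolding Z_def by (intro compact_suspension closed_T)
lemma connected_Z: "connected Z" unfolding Z_def T_def by (intro connected_suspension_orbit) auto

lemma glue_Z: "d \<in> D \<Longrightarrow> glue (shift k u, d) \<in> Z"
  unfolding Z_def suspension_def using shift_T by blast

lemma Z_meets_orbit: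
  assumes "open V" "V \<inter> Z \<noteq> {}"
  obtains k d where "d \<in> D" "glue (shift k u, d) \<in> V"
proof -
  obtain t d where td: "t \<in> T" "d \<in> D" "glue (t, d) \<in> V" using assms by (auto simp: Z_def suspension_def)
  have "continuous_on UNIV (\<lambda>t. glue (t, d))"
    by (rule continuous_on_compose2[OF continuous_glue]) (auto intro!: continuous_intros)
  with assms(1) have "open ((\<lambda>t. glue (t, d)) -` V)" by (rule open_vimage)
  then obtain J where J: "finite J" "{x. \<forall>j\<in>J. x j = t j} \<subseteq> (\<lambda>t. glue (t, d)) -` V"
    using open_contains_cylinder td by blast
  obtain k where "\<forall>j\<in>J. shift k u j = t j"
    using td(1) J(1) unfolding T_def closure_bool_fun_iff orbit_def by blast
  then have "shift k u \<in> {x. \<forall>j\<in>J. x j = t j}" by simp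
  then have "glue (shift k u, d) \<in> V" using J(2) by blast
  then show thesis using that td(2) by blast
qed

lemma glue_open_nbhd:
  assumes "open V" "glue (shift k u, d) \<in> V"
  obtains J N where "finite J" "open N" "d \<in> N"
    "\<And>t d'. \<lbrakk>d' \<in> N; \<And>i m. (i, m) \<in> J \<Longrightarrow> t (i, m + k) = u (i, m + k)\<rbrakk> \<Longrightarrow> glue (shift k t, d') \<in> V"
proof -
  have "open (glue -` V)" using assms(1) continuous_glue by (rule open_vimage)
  moreover have "(shift k u, d) \<in> glue -` V" using assms(2) by simp
  ultimately obtain A N where AN: "open A" "open N" "shift k u \<in> A" "d \<in> N" "A \<times> N \<subseteq> glue -` V"
    by (rule open_prod_elim) auto
  obtain J where J: "finite J" "{x. \<forall>j\<in>J. x j = shift k u j} \<subseteq> A"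
    using open_contains_cylinder[OF AN(1,3)] .
  show thesis
  proof (rule that[OF J(1) AN(2,4)])
    fix t d' assume "d' \<in> N" and t: "\<And>i m. (i, m) \<in> J \<Longrightarrow> t (i, m + k) = u (i, m + k)"
    have "shift k t \<in> A" using J(2) t by (force simp: shift_apply)
    with \<open>d' \<in> N\<close> AN(5) show "glue (shift k t, d') \<in> V" by auto
  qed
qed

text \<open>
  The cells \<open>k1\<close> and \<open>k2\<close> over arrays close to \<open>u\<close> are cut by the complement of \<open>A\<close>, and a cell \<open>k\<close>
  strictly between them meets the interior of \<open>A\<close>. The stretch of cells between the cuts, over the
  clopen set \<open>W\<close> of arrays, is closed, and so is the remainder; they cover \<open>A\<close> without meeting. So \<open>A\<close>
  lies in the stretch. Every array involved in the stretch has a mark in row \<open>i\<close> near the origin, whereas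
  some point in the interior of \<open>A\<close> is over an array without such a mark.
\<close>
lemma subcontinuum_with_interior:
  assumes A: "A \<subseteq> Z" "closed A" "connected A" and U: "open U" "U \<inter> Z \<noteq> {}" "U \<inter> Z \<subseteq> A"
  shows "A = Z"
proof (rule ccontr)
  assume "A \<noteq> Z"
  then have V: "open (- A)" "- A \<inter> Z \<noteq> {}" using A by auto
  obtain k1 d1 where d1: "d1 \<in> D" "glue (shift k1 u, d1) \<in> - A" using Z_meets_orbit[OF V] .
  obtain J1 N where J1: "finite J1" "open N" "d1 \<in> N"
    "\<And>t d. \<lbrakk>d \<in> N; \<And>i m. (i, m) \<in> J1 \<Longrightarrow> t (i, m + k1) = u (i, m + k1)\<rbrakk> \<Longrightarrow> glue (shift k1 t, d) \<in> - A"
    using glue_open_nbhd[OF V(1) d1(2)] by metis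
  obtain M1 where M1: "0 \<le> M1" "\<And>i m. (i, m) \<in> J1 \<Longrightarrow> \<bar>m\<bar> \<le> M1" using finite_int_bound[OF J1(1)] by blast
  define Q1 where "Q1 = fst ` J1"
  have "finite Q1" using J1(1) by (simp add: Q1_def)
  have ND: "N \<inter> D \<noteq> {}" using d1(1) J1(3) by auto
  obtain P P' where P: "closed P" "closed P'" "P \<inter> P' = {}" "P \<union> P' = D - N" "(p, -1) \<notin> P'" "(p, 1) \<notin> P"
    by (rule irreducible_separation[OF compact_D ND J1(2) irreducible])
  obtain k0 d0 where d0: "d0 \<in> D" "glue (shift k0 u, d0) \<in> U" using Z_meets_orbit[OF U(1,2)] .
  obtain J0 N0 where J0: "finite J0" "d0 \<in> N0"
    "\<And>t d. \<lbrakk>d \<in> N0; \<And>i m. (i, m) \<in> J0 \<Longrightarrow> t (i, m + k0) = u (i, m + k0)\<rbrakk> \<Longrightarrow> glue (shift k0 t, d) \<in> U"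
    using glue_open_nbhd[OF U(1) d0(2)] by metis
  obtain M0 where M0: "0 \<le> M0" "\<And>i m. (i, m) \<in> J0 \<Longrightarrow> \<bar>m\<bar> \<le> M0" using finite_int_bound[OF J0(1)] by blast
  define Q0 where "Q0 = fst ` J0"
  have "finite Q0" using J0(1) by (simp add: Q0_def)
  obtain i where i: "i \<in> I - Q0" using infinite_I \<open>finite Q0\<close> by (metis Diff_eq_empty_iff all_not_in_conv finite_subset)
  obtain i1 where i1: "i1 \<in> I - Q1" using infinite_I \<open>finite Q1\<close> by (metis Diff_eq_empty_iff all_not_in_conv finite_subset)
  \<comment> \<open>any recurrence of the rows in \<open>Q0\<close> gives another cell that meets \<open>U\<close>\<close>
  have inU: "glue (shift (k0 + s) u, d0) \<in> U"
    if "\<forall>j\<in>Q0. \<forall>m. \<bar>m\<bar> \<le> M0 + \<bar>k0\<bar> \<longrightarrow> u (j, m + s) = u (j, m)" for s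
  proof -
    have "shift s u (j, m + k0) = u (j, m + k0)" if "(j, m) \<in> J0" for j m
    proof -
      have "\<bar>m + k0\<bar> \<le> M0 + \<bar>k0\<bar>" using M0(2)[OF that] by linarith
      moreover have "j \<in> Q0" using that by (force simp: Q0_def)
      ultimately show ?thesis using \<open>\<forall>j\<in>Q0. _ j\<close> by (simp add: shift_apply)
    qed
    from J0(3)[of d0 "shift s u", OF J0(2) this] show ?thesis by simp
  qed
  obtain s0 where s0: "M0 + \<bar>k0\<bar> + \<bar>k1 - k0\<bar> < s0"
     "\<forall>j\<in>Q0. \<forall>m. \<bar>m\<bar> \<le> M0 + \<bar>k0\<bar> + \<bar>k1 - k0\<bar> \<longrightarrow> u (j, m + s0) = u (j, m)"
    using recurrent[OF \<open>finite Q0\<close> i, of "M0 + \<bar>k0\<bar> + \<bar>k1 - k0\<bar>"] by blast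
  \<comment> \<open>a cell beyond \<open>k1\<close> that meets \<open>U\<close>\<close>
  define k where "k = k0 + s0"
  have k: "k1 < k" using s0(1) M0(1) by (simp add: k_def)
  obtain s1 where s1: "M1 + \<bar>k1\<bar> + (k - k1) < s1"
     "\<forall>j\<in>Q1. \<forall>m. \<bar>m\<bar> \<le> M1 + \<bar>k1\<bar> + (k - k1) \<longrightarrow> u (j, m + s1) = u (j, m)"
    using recurrent[OF \<open>finite Q1\<close> i1, of "M1 + \<bar>k1\<bar> + (k - k1)"] by blast
  \<comment> \<open>a repetition of cell \<open>k1\<close> beyond \<open>k\<close>\<close>
  define k2 where "k2 = k1 + s1"
  have k2: "k < k2" using s1(1) M1(1) by (simp add: k2_def)
  \<comment> \<open>arrays in \<open>W\<close> agree with \<open>u\<close> at all positions that matter for cells \<open>k1\<close> and \<open>k2\<close>; row \<open>i\<close> is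
    included so that the stretch over \<open>W\<close> misses a point over an array in which this row vanishes\<close>
  define R where "R = M1 + \<bar>k1\<bar> + s1"
  define W where "W = {t. \<forall>j\<in>insert i Q1 \<times> {-R..R}. t j = u j}"
  have "finite (insert i Q1 \<times> {-R..R})" using \<open>finite Q1\<close> by simp
  then have openW: "open W" unfolding W_def by (rule open_cylinder)
  have closedW: "closed W" unfolding W_def by (rule closed_cylinder) fact
  have uW: "u \<in> W" by (simp add: W_def)
  have R0: "0 \<le> R" using M1(1) s1(1) k by (simp add: R_def)
  have blocked: "glue (shift k1 t, d) \<in> - A" "glue (shift k2 t, d) \<in> - A" if "t \<in> W" "d \<in> N" for t d
  proof -
    have t: "t (j, m) = u (j, m)" if "j \<in> Q1" "\<bar>m\<bar> \<le> R" for j m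
    proof -
      have "(j, m) \<in> insert i Q1 \<times> {-R..R}" using that by auto
      with \<open>t \<in> W\<close> show ?thesis unfolding W_def by blast
    qed
    have Q: "j \<in> Q1" if "(j, m) \<in> J1" for j m using that by (force simp: Q1_def)
    have "0 \<le> s1" using s1(1) M1(1) k by linarith
    have b1: "\<bar>m + k1\<bar> \<le> R" "\<bar>m + k1 + s1\<bar> \<le> R" "\<bar>m + k1\<bar> \<le> M1 + \<bar>k1\<bar> + (k - k1)" if "(j, m) \<in> J1" for j m
      using M1(2)[OF that] \<open>0 \<le> s1\<close> k unfolding R_def by linarith+
    show "glue (shift k1 t, d) \<in> - A"
      using that(2) by (rule J1(4)) (use t Q b1 in blast)
    have "glue (shift k1 (shift s1 t), d) \<in> - A"
      using that(2)
    proof (rule J1(4))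
      fix j m assume jm: "(j, m) \<in> J1"
      have "shift s1 t (j, m + k1) = u (j, m + k1 + s1)"
        using t[OF Q[OF jm] b1(2)[OF jm]] by (simp add: shift_apply)
      also have "\<dots> = u (j, m + k1)" using s1(2) Q[OF jm] b1(3)[OF jm] by blast
      finally show "shift s1 t (j, m + k1) = u (j, m + k1)" .
    qed
    then show "glue (shift k2 t, d) \<in> - A" by (simp add: k2_def)
  qed
  \<comment> \<open>\<open>F j\<close> is the part of cell \<open>j\<close> between the cuts, \<open>F' j\<close> the part outside them\<close>
  define F where "F j = (if j = k1 then P' else if j = k2 then P else D)" for j
  define F' where "F' j = (if j = k1 then P else if j = k2 then P' else {})" for j
  have closedD: "closed D" by (rule compact_imp_closed[OF compact_D])
  have closedF: "closed (F j)" "closed (F' j)" for j using P closedD by (auto simp: F_def F'_def)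
  have FF': "F j \<inter> F' j = {}" for j using P by (auto simp: F_def F'_def)
  define X where "X = (T \<times> D) \<inter> (\<Union>j\<in>{k1..k2}. (shift (-j) -` W) \<times> F j)"
  define X' where "X' = (T \<times> D) \<inter> (\<Inter>j\<in>{k1..k2}. (- (shift (-j) -` W)) \<times> UNIV \<union> UNIV \<times> F' j)"
  have vim: "open (shift (-j) -` W)" "closed (shift (-j) -` W)" for j
    using openW closedW continuous_shift by (auto intro: open_vimage closed_vimage)
  have compTD: "compact (T \<times> D)"
    using compact_Int_closed[OF compact_bool_fun closed_T] compact_D by (intro compact_Times) auto
  have "compact X" unfolding X_def
    by (intro compact_Int_closed compTD closed_UN ballI closed_Times vim closedF) simp
  moreover have "compact X'" unfolding X'_def
    by (intro compact_Int_closed compTD closed_INT ballI closed_Un closed_Times closed_Compl vim closedF closed_UNIV)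
  ultimately have closed_glue: "closed (glue ` X)" "closed (glue ` X')"
    using compact_imp_closed_prod_fun[OF compact_continuous_image[OF continuous_glue']] by blast+
  have cover: "A \<subseteq> glue ` X \<union> glue ` X'"
  proof
    fix z assume z: "z \<in> A"
    then obtain t d where td: "t \<in> T" "d \<in> D" "z = glue (t, d)" using A(1) by (auto simp: Z_def suspension_def)
    show "z \<in> glue ` X \<union> glue ` X'"
    proof (cases "(t, d) \<in> X")
      case False
      have "d \<in> F' j" if j: "j \<in> {k1..k2}" "shift (- j) t \<in> W" for j
      proof -
        have "d \<notin> F j" using False td j by (auto simp: X_def)
        then consider "j = k1" "d \<notin> P'" | "j = k2" "d \<notin> P" "j \<noteq> k1" using td(2) by (auto simp: F_def split: if_splits)
        moreover have "d \<notin> N" if "j = k1 \<or> j = k2"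
        proof
          assume "d \<in> N"
          from blocked[OF j(2) this] that have "glue (t, d) \<in> - A" by auto
          with z td show False by simp
        qed
        ultimately show ?thesis using P(4) td(2) k k2 by cases (auto simp: F'_def)
      qed
      then have "(t, d) \<in> X'" using td by (auto simp: X'_def)
      then show ?thesis using td(3) by blast
    qed (use td in blast)
  qed
  have disj: "glue ` X \<inter> glue ` X' = {}"
  proof (rule ccontr)
    assume "glue ` X \<inter> glue ` X' \<noteq> {}"
    then obtain x x' where "x \<in> X" "x' \<in> X'" "glue x = glue x'" by blast
    then obtain t d t' d' where x: "(t, d) \<in> X" "(t', d') \<in> X'" "glue (t, d) = glue (t', d')"
      by (metis surj_pair)
    have DD: "d \<in> D" "d' \<in> D" using x by (auto simp: X_def X'_def)
    obtain j where j: "j \<in> {k1..k2}" "shift (- j) t \<in> W" "d \<in> F j" using x(1) by (auto simp: X_def)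
    have x': "d' \<in> F' l" if "l \<in> {k1..k2}" "shift (- l) t' \<in> W" for l using x(2) that by (auto simp: X'_def)
    from glue_eqD[OF x(3) DD] consider "d = d'" "t = t'"
      | "d = (p, 1)" "d' = (p, -1)" "t' = shift 1 t" | "d = (p, -1)" "d' = (p, 1)" "t = shift 1 t'" by blast
    then show False
    proof cases
      case 1 then show False using x'[OF j(1)] j FF'[of j] by auto
    next
      case 2
      have "j \<noteq> k2" using j(3) 2 P k k2 by (auto simp: F_def)
      then have "j + 1 \<in> {k1..k2}" using j(1) by auto
      moreover have "shift (- (j + 1)) t' \<in> W" using j(2) 2 by simp
      ultimately have "d' \<in> F' (j + 1)" by (rule x')
      then show False using 2 P j(1) by (auto simp: F'_def split: if_splits)
    next
      case 3
      have "j \<noteq> k1" using j(3) 3 P by (auto simp: F_def)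
      then have "j - 1 \<in> {k1..k2}" using j(1) by auto
      moreover have "shift (- (j - 1)) t' \<in> W" using j(2) 3 by simp
      ultimately have "d' \<in> F' (j - 1)" by (rule x')
      then show False using 3 P j(1) by (auto simp: F'_def split: if_splits)
    qed
  qed
  have "glue (shift k u, d0) \<in> U" unfolding k_def by (rule inU) (use s0(2) in auto)
  then have "glue (shift k u, d0) \<in> A" using U(3) glue_Z[OF d0(1)] by blast
  moreover have "(shift k u, d0) \<in> X"
    using shift_T d0(1) k k2 uW by (auto simp: X_def F_def intro!: bexI[of _ k])
  ultimately have "glue ` X \<inter> A \<noteq> {}" by blast
  then have AX: "A \<subseteq> glue ` X"
    using connected_closedD[OF A(3) _ cover closed_glue] disj cover by blast
  \<comment> \<open>a further recurrence of the rows in \<open>Q0\<close> at which row \<open>i\<close> vanishes\<close>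
  define M where "M = M0 + \<bar>k0\<bar> + \<bar>k\<bar> + 1 + \<bar>k1\<bar> + \<bar>k2\<bar>"
  obtain s where s: "\<forall>j\<in>Q0. \<forall>m. \<bar>m\<bar> \<le> M + s0 \<longrightarrow> u (j, m + s) = u (j, m)" "\<forall>m. \<bar>m\<bar> \<le> M + s0 \<longrightarrow> \<not> u (i, m + s)"
    using recurrent[OF \<open>finite Q0\<close> i, of "M + s0"] by blast
  have "0 \<le> s0" using s0(1) M0(1) by linarith
  have "glue (shift (k0 + (s0 + s)) u, d0) \<in> U"
  proof (rule inU, intro ballI allI impI)
    fix j m assume j: "j \<in> Q0" "\<bar>m\<bar> \<le> M0 + \<bar>k0\<bar>"
    then have "\<bar>m + s0\<bar> \<le> M + s0" using \<open>0 \<le> s0\<close> by (simp add: M_def)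
    then have "u (j, m + s0 + s) = u (j, m + s0)" using s(1) j by blast
    also have "\<dots> = u (j, m)" using s0(2) j by auto
    finally show "u (j, m + (s0 + s)) = u (j, m)" by (simp add: add.assoc)
  qed
  then have "glue (shift (k + s) u, d0) \<in> U" by (simp add: k_def add.assoc)
  then have "glue (shift (k + s) u, d0) \<in> glue ` X" using U(3) glue_Z[OF d0(1)] AX by blast
  then obtain t d where td: "(t, d) \<in> X" "glue (shift (k + s) u, d0) = glue (t, d)" by auto
  then have "d \<in> D" by (auto simp: X_def)
  from glue_eqD[OF td(2) d0(1) this] obtain e where e: "\<bar>e\<bar> \<le> 1" "t = shift (k + s + e) u"
  proof (elim disjE conjE, goal_cases)
    case 1 then show ?case using 1(1)[of 0] by simp
  next
    case 2 then show ?case using 2(1)[of 1] by (simp add: add.commute)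
  next
    case 3
    then have "shift (-1) (shift (k + s) u) = shift (-1) (shift 1 t)" by simp
    then show ?case using 3(1)[of "-1"] by simp
  qed
  obtain j where j: "j \<in> {k1..k2}" "shift (- j) t \<in> W" using td(1) by (auto simp: X_def)
  have "shift (- j) t (i, 0) = u (i, 0)" using j(2) R0 by (auto simp: W_def)
  then have "u (i, (k + e - j) + s)" using u_zero i e(2) by (simp add: shift_apply algebra_simps)
  moreover have "\<bar>k + e - j\<bar> \<le> M + s0" using e(1) j(1) M0(1) \<open>0 \<le> s0\<close> unfolding M_def by auto
  ultimately show False using s(2) by blast
qed

end

section \<open>Proper subcontinua covering the suspension\<close>

context marked_cell
begin

text \<open>
  The two kinds of proper subcontinua that cover the suspension: one for each row \<open>i\<close>, in which this
  row has been erased, and one for each backward half orbit.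
\<close>
definition vanishing :: "'i \<Rightarrow> ('b \<times> (('i \<times> int) option \<times> bool \<Rightarrow> real)) set" where
  "vanishing i = suspension (closure (orbit UNIV (erase i u)))"
definition initial :: "int \<Rightarrow> ('b \<times> (('i \<times> int) option \<times> bool \<Rightarrow> real)) set" where
  "initial n = suspension (closure (orbit {..n} u))"

lemma erase_neg: "k < 0 \<Longrightarrow> \<not> erase i u (j, k)"
  using u_neg by (simp add: erase_def)

text \<open>
  Far to the left the array vanishes, so the zero array is a limit of backward shifts. It provides a
  point that all the covering subcontinua share.
\<close>
lemma all_False_in_closure:
  fixes t :: "'j \<times> int \<Rightarrow> bool"
  assumes neg: "\<And>i k. k < 0 \<Longrightarrow> \<not> t (i, k)" and S: "\<And>N. \<exists>k\<in>S. k < N"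
  shows "(\<lambda>_. False) \<in> closure (orbit S t)"
  unfolding closure_bool_fun_iff
proof (intro allI impI)
  fix J :: "('j \<times> int) set" assume "finite J"
  then obtain M where M: "\<And>i m. (i, m) \<in> J \<Longrightarrow> \<bar>m\<bar> \<le> M" using finite_int_bound by blast
  obtain k where k: "k \<in> S" "k < - M" using S by blast
  have "\<not> shift k t j" if "j \<in> J" for j
  proof -
    obtain i m where j: "j = (i, m)" by fastforce
    then have "\<bar>m\<bar> \<le> M" using M that by blast
    then have "m + k < 0" using k(2) by linarith
    then show ?thesis using neg by (simp add: j shift_apply)
  qed
  then show "\<exists>x\<in>orbit S t. \<forall>j\<in>J. x j = False"
    using k(1) by (intro bexI[of _ "shift k t"]) (simp_all add: orbit_def)
qed

text \<open>
  Finitely many rows of \<open>u\<close> other than row \<open>i\<close> recur at places where row \<open>i\<close> vanishes, so \<open>u\<close> with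
  row \<open>i\<close> erased is a limit of shifts of \<open>u\<close>.
\<close>
lemma vanishing_subset:
  assumes i: "i \<in> I"
  shows "vanishing i \<subseteq> Z"
proof -
  have "shift k (erase i u) \<in> T" for k
    unfolding T_def closure_bool_fun_iff
  proof (intro allI impI)
    fix J :: "('i \<times> int) set" assume J: "finite J"
    then obtain M where M: "0 \<le> M" "\<And>i m. (i, m) \<in> J \<Longrightarrow> \<bar>m\<bar> \<le> M" using finite_int_bound by blast
    have "finite (fst ` J - {i})" "i \<in> I - (fst ` J - {i})" using J i by auto
    then obtain s where s: "\<forall>j\<in>fst ` J - {i}. \<forall>m. \<bar>m\<bar> \<le> M + \<bar>k\<bar> \<longrightarrow> u (j, m + s) = u (j, m)"
      "\<forall>m. \<bar>m\<bar> \<le> M + \<bar>k\<bar> \<longrightarrow> \<not> u (i, m + s)"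
      using recurrent[of "fst ` J - {i}" i "M + \<bar>k\<bar>"] by blast
    have "shift (k + s) u (j, m) = shift k (erase i u) (j, m)" if jm: "(j, m) \<in> J" for j m
    proof -
      have "\<bar>m + k\<bar> \<le> M + \<bar>k\<bar>" using M(2)[OF jm] by linarith
      moreover have "j \<in> fst ` J" using jm by force
      ultimately show ?thesis using s by (cases "j = i") (simp_all add: shift_apply erase_def add.assoc[symmetric])
    qed
    then show "\<exists>x\<in>orbit UNIV u. \<forall>j\<in>J. x j = shift k (erase i u) j"
      by (intro bexI[of _ "shift (k + s) u"]) (auto simp: orbit_def)
  qed
  then have "closure (orbit UNIV (erase i u)) \<subseteq> T"
    by (intro closure_minimal closed_T) (auto simp: orbit_def)
  then show ?thesis unfolding vanishing_def Z_def by (rule suspension_mono)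
qed

lemma initial_subset: "initial n \<subseteq> Z"
  unfolding initial_def Z_def T_def by (intro suspension_mono closure_mono) (auto simp: orbit_def)

lemma middle_mem_suspensionD: "glue (t, (q, 0)) \<in> suspension S \<Longrightarrow> t \<in> S"
  using glue_eqD[OF _ middle] by (fastforce simp: suspension_def)

lemma vanishing_proper:
  assumes i: "i \<in> I"
  shows "vanishing i \<noteq> Z"
proof
  assume "vanishing i = Z"
  moreover have "glue (u, (q, 0)) \<in> Z" using glue_Z[OF middle, of 0] by simp
  ultimately have "glue (u, (q, 0)) \<in> suspension (closure (orbit UNIV (erase i u)))" by (simp add: vanishing_def)
  then have "u \<in> closure (orbit UNIV (erase i u))" by (rule middle_mem_suspensionD)
  then obtain x where "x \<in> orbit UNIV (erase i u)" "\<forall>j\<in>{(i, 0)}. x j = u j"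
    unfolding closure_bool_fun_iff by blast
  then show False using u_zero[OF i] by (auto simp: orbit_def shift_apply erase_def)
qed

lemma initial_proper: "initial n \<noteq> Z"
proof
  obtain i where i: "i \<in> I" using infinite_I by fastforce
  assume "initial n = Z"
  moreover have "glue (shift (n + 1) u, (q, 0)) \<in> Z" by (rule glue_Z[OF middle])
  ultimately have "glue (shift (n + 1) u, (q, 0)) \<in> suspension (closure (orbit {..n} u))" by (simp add: initial_def)
  then have "shift (n + 1) u \<in> closure (orbit {..n} u)" by (rule middle_mem_suspensionD)
  then obtain x where "x \<in> orbit {..n} u" "\<forall>j\<in>{(i, - (n + 1))}. x j = shift (n + 1) u j"
    unfolding closure_bool_fun_iff by blast
  then obtain k where "k \<le> n" "u (i, k - (n + 1)) = u (i, 0)" by (auto simp: orbit_def shift_apply algebra_simps)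
  then show False using u_zero[OF i] u_neg[of "k - (n + 1)" i] by auto
qed

text \<open>
  A point over a shift of \<open>u\<close> is on a backward half orbit. If row \<open>i\<close> of a limit of shifts of \<open>u\<close> is
  zero, then erasing row \<open>i\<close> in the approximating shifts does not change the limit.
\<close>
lemma Z_cases:
  assumes "z \<in> Z"
  obtains i where "i \<in> I" "z \<in> vanishing i" | n where "z \<in> initial n"
proof -
  obtain t d where td: "t \<in> T" "d \<in> D" "z = glue (t, d)" using assms by (auto simp: Z_def suspension_def)
  from limit_cases[OF td(1)[unfolded T_def]] consider i where "i \<in> I" "\<forall>m. \<not> t (i, m)" | n where "t = shift n u" by blast
  then show thesis
  proof cases
    case (1 i)
    have "t \<in> closure (orbit UNIV (erase i u))"
      unfolding closure_bool_fun_iff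
    proof (intro allI impI)
      fix J :: "('i \<times> int) set" assume "finite J"
      then obtain k where k: "\<forall>j\<in>J. shift k u j = t j" using td(1) unfolding T_def closure_bool_fun_iff orbit_def by blast
      have "shift k (erase i u) j = t j" if "j \<in> J" for j
      proof -
        obtain i' m where j: "j = (i', m)" by fastforce
        then show ?thesis using bspec[OF k that] 1(2) by (cases "i' = i") (auto simp: shift_apply erase_def)
      qed
      then show "\<exists>x\<in>orbit UNIV (erase i u). \<forall>j\<in>J. x j = t j"
        by (intro bexI[of _ "shift k (erase i u)"]) (simp_all add: orbit_def)
    qed
    then have "z \<in> vanishing i" using td(2,3) by (auto simp: vanishing_def suspension_def)
    with 1(1) show thesis by (rule that(1))
  next
    case (2 n)
    have "t \<in> closure (orbit {..n} u)"
      by (rule closure_subset[THEN subsetD]) (auto simp: 2 orbit_def)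
    then have "z \<in> initial n" using td(2,3) by (auto simp: initial_def suspension_def)
    then show thesis by (rule that(2))
  qed
qed

end


lemma continuum_top_of_set:
  fixes S :: "('b::t2_space \<times> ('i \<Rightarrow> real)) set"
  shows "continuum (top_of_set S) \<longleftrightarrow> compact S \<and> connected S \<and> (\<exists>x\<in>S. \<exists>y\<in>S. x \<noteq> y)"
proof -
  have "Hausdorff_space (top_of_set S)"
    by (intro Hausdorff_space_subtopology Hausdorff_space_euclidean_prod_fun)
  moreover have "compact_space (top_of_set S) \<longleftrightarrow> compact S"
    using compactin_subspace[of euclidean S] by simp
  moreover have "connected_space (top_of_set S) \<longleftrightarrow> connected S"
    using connectedin_iff_connected[of S] by (simp add: connectedin_def)
  ultimately show ?thesis by (simp add: continuum_def)
qed

lemma proper_subcontinuum_top_of_set: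
  fixes S :: "('b::t2_space \<times> ('i \<Rightarrow> real)) set"
  shows "proper_subcontinuum (top_of_set S) K \<longleftrightarrow>
    K \<subseteq> S \<and> K \<noteq> S \<and> compact K \<and> connected K \<and> (\<exists>x\<in>K. \<exists>y\<in>K. x \<noteq> y)"
proof -
  have "subtopology (top_of_set S) K = top_of_set K" if "K \<subseteq> S"
    using that by (simp add: subtopology_subtopology Int_absorb1)
  then show ?thesis
    unfolding proper_subcontinuum_def subcontinuum_def topspace_euclidean_subtopology
    using continuum_top_of_set[of K] by (cases "K \<subseteq> S") (simp_all add: conj_ac)
qed

context marked_cell
begin

lemma continuum_Z: "continuum (top_of_set Z)"
  unfolding continuum_top_of_set using compact_Z connected_Z two_points_suspension[OF u_T] by (simp add: Z_def)

text \<open>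
  In a decomposition each part would contain the complement of the other one, hence have interior.
\<close>
lemma indecomposable_Z: "indecomposable (top_of_set Z)"
  unfolding indecomposable_def proper_subcontinuum_top_of_set
proof (rule notI, elim exE conjE)
  fix A B assume AB: "A \<subseteq> Z" "B \<subseteq> Z" "A \<noteq> Z" "B \<noteq> Z" "compact A" "compact B" "connected A"
    "topspace (top_of_set Z) = A \<union> B"
  then have "closed A" "closed B" by (simp_all add: compact_imp_closed_prod_fun)
  moreover have "- B \<inter> Z \<noteq> {}" "- B \<inter> Z \<subseteq> A" using AB by auto
  ultimately have "A = Z" using subcontinuum_with_interior[of A "- B"] AB by auto
  with AB show False by simp
qed

lemma proper_subcontinuum_vanishing: "i \<in> I \<Longrightarrow> proper_subcontinuum (top_of_set Z) (vanishing i)"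
  unfolding proper_subcontinuum_top_of_set
  using vanishing_subset vanishing_proper all_False_in_closure[of "erase i u" UNIV, OF erase_neg]
  by (auto simp: vanishing_def intro!: compact_suspension connected_suspension_orbit two_points_suspension intro: gt_ex lt_ex)

lemma proper_subcontinuum_initial: "proper_subcontinuum (top_of_set Z) (initial n)"
proof -
  have "shift n u \<in> closure (orbit {..n} u)"
    by (rule closure_subset[THEN subsetD]) (auto simp: orbit_def)
  then show ?thesis
    unfolding proper_subcontinuum_top_of_set
    using initial_subset initial_proper
    by (auto simp: initial_def intro!: compact_suspension connected_suspension_orbit two_points_suspension)
qed

lemma joined_to_base:
  assumes "z \<in> Z"
  obtains K where "proper_subcontinuum (top_of_set Z) K" "z \<in> K" "glue (\<lambda>_. False, (q, 0)) \<in> K"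
  using assms
proof (cases z rule: Z_cases)
  case (1 i)
  have "(\<lambda>_. False) \<in> closure (orbit UNIV (erase i u))"
    by (rule all_False_in_closure) (auto simp: erase_neg intro: lt_ex)
  then have "glue (\<lambda>_. False, (q, 0)) \<in> vanishing i" using middle by (auto simp: vanishing_def suspension_def)
  then show thesis using that proper_subcontinuum_vanishing 1 by blast
next
  case (2 n)
  have "\<exists>k\<in>{..n}. k < N" for N by (rule bexI[of _ "min n (N - 1)"]) auto
  then have "(\<lambda>_. False) \<in> closure (orbit {..n} u)"
    by (intro all_False_in_closure u_neg)
  then have "glue (\<lambda>_. False, (q, 0)) \<in> initial n" using middle by (auto simp: initial_def suspension_def)
  then show thesis using that proper_subcontinuum_initial 2 by blast
qed

text \<open>
  Two proper subcontinua with a common point have a connected union, which is still proper because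
  the suspension is indecomposable.
\<close>
lemma joined_Z:
  assumes "x \<in> Z" "y \<in> Z"
  shows "\<exists>K. proper_subcontinuum (top_of_set Z) K \<and> x \<in> K \<and> y \<in> K"
proof -
  let ?e = "glue (\<lambda>_. False, (q, 0))"
  obtain K where K: "proper_subcontinuum (top_of_set Z) K" "x \<in> K" "?e \<in> K" by (rule joined_to_base[OF assms(1)])
  obtain L where L: "proper_subcontinuum (top_of_set Z) L" "y \<in> L" "?e \<in> L" by (rule joined_to_base[OF assms(2)])
  have "K \<union> L \<noteq> Z" using indecomposable_Z K(1) L(1) by (auto simp: indecomposable_def)
  moreover have "connected (K \<union> L)" using K L by (auto simp: proper_subcontinuum_top_of_set intro!: connected_Un)
  moreover have "compact (K \<union> L)" using K L by (auto simp: proper_subcontinuum_top_of_set)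
  ultimately have "proper_subcontinuum (top_of_set Z) (K \<union> L)"
    using K(1) L(1) unfolding proper_subcontinuum_top_of_set by blast
  then show ?thesis using K L by blast
qed

lemma separable_Z:
  assumes B: "countable B" "B \<subseteq> D" "D \<subseteq> closure B"
  shows "separable_space (top_of_set Z)"
proof -
  define S where "S = glue ` (orbit UNIV u \<times> B)"
  have "countable S" unfolding S_def orbit_def using B(1) by (intro countable_image countable_SIGMA) auto
  moreover have SZ: "S \<subseteq> Z" using glue_Z B(2) by (auto simp: S_def orbit_def)
  moreover have "Z \<subseteq> closure S"
  proof -
    have "Z \<subseteq> glue ` closure (orbit UNIV u \<times> B)" using B(3) by (auto simp: Z_def suspension_def T_def closure_Times)
    also have "\<dots> \<subseteq> closure S"
      unfolding S_def by (intro image_closure_subset continuous_glue') (auto intro: closure_subset[THEN subsetD])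
    finally show ?thesis .
  qed
  ultimately show ?thesis
    unfolding separable_space_def by (intro exI[of _ S]) (auto simp: closure_of_subtopology Int_absorb1)
qed

lemma continuous_embed: "continuous_on S (\<lambda>y. glue (u, (y, 0)))"
  by (rule continuous_on_compose2[OF continuous_glue]) (auto intro!: continuous_intros)

end

section \<open>Bellamy continua that retract onto a given continuum\<close>

lemma bellamy_continuumI:
  assumes "continuum X" "indecomposable X"
    and "\<And>x y. \<lbrakk>x \<in> topspace X; y \<in> topspace X\<rbrakk> \<Longrightarrow> \<exists>K. proper_subcontinuum X K \<and> x \<in> K \<and> y \<in> K"
  shows "bellamy_continuum X"
proof -
  have "composant X x = topspace X" if "x \<in> topspace X" for x
    using assms(3)[OF that] unfolding composant_def proper_subcontinuum_def subcontinuum_def by blast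
  then have "composant X ` topspace X = {topspace X}"
    using assms(1) by (auto simp: continuum_def image_iff)
  then show ?thesis using assms by (simp add: bellamy_continuum_def)
qed


lemma mark_marked_cell:
  assumes "cell D p q" "strongly_independent \<F>" and pseudo: "\<And>B. infinite B \<Longrightarrow> \<exists>A\<in>\<F>. infinite (B - A)"
  shows "marked_cell D p q (mark \<F>) \<F>"
proof -
  interpret cell D p q by fact
  show ?thesis
  proof
    show "infinite \<F>"
    proof
      assume fin: "finite \<F>"
      then have "infinite (\<Inter>\<F>)" using assms(2) by (simp add: strongly_independent_def)
      from pseudo[OF this] obtain A where "A \<in> \<F>" "infinite (\<Inter>\<F> - A)" by blast
      moreover from \<open>A \<in> \<F>\<close> have "\<Inter>\<F> - A = {}" by blast
      ultimately show False by simp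
    qed
    show "\<not> mark \<F> (i, k)" if "k < 0" for i k using mark_neg that .
    show "mark \<F> (i, 0)" if "i \<in> \<F>" for i using mark_zero that .
    show "\<exists>s>M. (\<forall>j\<in>Q. \<forall>m. \<bar>m\<bar> \<le> M \<longrightarrow> mark \<F> (j, m + s) = mark \<F> (j, m)) \<and> (\<forall>m. \<bar>m\<bar> \<le> M \<longrightarrow> \<not> mark \<F> (i, m + s))"
      if "finite Q" "i \<in> \<F> - Q" for i Q M
      by (rule mark_recurrent[OF assms(2) that(2,1), of M]) blast
    show "(\<exists>i\<in>\<F>. \<forall>m. \<not> t (i, m)) \<or> (\<exists>n. t = shift n (mark \<F>))"
      if t: "t \<in> closure (orbit UNIV (mark \<F>))" for t
    proof -
      have "\<exists>k. \<forall>j\<in>J. shift k (mark \<F>) j = t j" if "finite J" for J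
        using t that unfolding closure_bool_fun_iff orbit_def by blast
      from mark_limit_cases[OF pseudo this] show ?thesis by blast
    qed
  qed
qed

lemma tail_dense_sequence:
  fixes Y :: "'b::{metric_space,second_countable_topology} set"
  assumes "Y \<noteq> {}"
  obtains g :: "nat \<Rightarrow> 'b" where "range g \<subseteq> Y" "\<forall>n. Y \<subseteq> closure (g ` {n..})"
proof -
  obtain B where B: "countable B" "B \<subseteq> Y" "Y \<subseteq> closure B" using separable[of Y] by blast
  then have ne: "B \<noteq> {}" using assms by auto
  define g where "g n = from_nat_into B (fst (prod_decode n))" for n
  have "b \<in> g ` {n..}" if b: "b \<in> B" for b n
  proof -
    obtain m where m: "from_nat_into B m = b" using from_nat_into_surj[OF B(1) b] by blast
    have "g (prod_encode (m, n)) = b" by (simp add: g_def m)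
    moreover have "n \<le> prod_encode (m, n)" by (rule le_prod_encode_2)
    ultimately show ?thesis by (metis atLeast_iff imageI)
  qed
  then have "B \<subseteq> g ` {n..}" for n by blast
  then have "\<forall>n. Y \<subseteq> closure (g ` {n..})" using B(3) closure_mono by blast
  moreover have "range g \<subseteq> Y" using from_nat_into[OF ne] B(2) by (auto simp: g_def)
  ultimately show thesis by (rule that[rotated])
qed

text \<open>
  The suspension of the array of marks over a cell around \<open>Y\<close>. The conclusion lists the two properties
  that characterise it as a Bellamy continuum, a form that is easily moved along a homeomorphism.
\<close>
lemma bellamy_retract:
  fixes Y :: "'b::{metric_space,second_countable_topology} set"
  assumes Y: "compact Y" "connected Y" "Y \<noteq> {}"
  obtains Z :: "('b \<times> ((nat set \<times> int) option \<times> bool \<Rightarrow> real)) set" and e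
  where "continuum (top_of_set Z)" "indecomposable (top_of_set Z)"
    "\<forall>x\<in>Z. \<forall>y\<in>Z. \<exists>K. proper_subcontinuum (top_of_set Z) K \<and> x \<in> K \<and> y \<in> K"
    "separable_space (top_of_set Z)" "continuous_on Y e" "e ` Y \<subseteq> Z" "fst ` Z \<subseteq> Y" "\<forall>y\<in>Y. fst (e y) = y"
proof -
  obtain g :: "nat \<Rightarrow> 'b" where g: "range g \<subseteq> Y" "\<forall>n. Y \<subseteq> closure (g ` {n..})" by (rule tail_dense_sequence[OF Y(3)])
  obtain D where D: "cell D (g 0) (g 0)" "D \<subseteq> Y \<times> {-1..1}" "Y \<times> {0} \<subseteq> D"
    by (rule cell_exists[OF Y(1,2) g(1) g(2)[rule_format]])
  obtain \<F> where F: "strongly_independent \<F>" "\<forall>B. infinite B \<longrightarrow> (\<exists>A\<in>\<F>. infinite (B - A))"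
    using strongly_independent_no_pseudointersection .
  interpret marked_cell D "g 0" "g 0" "mark \<F>" \<F> by (rule mark_marked_cell[OF D(1) F(1) F(2)[rule_format]])
  obtain B where B: "countable B" "B \<subseteq> D" "D \<subseteq> closure B" using separable[of D] by blast
  show thesis
  proof (rule that[of Z "\<lambda>y. glue (mark \<F>, (y, 0))"])
    show "separable_space (top_of_set Z)" by (rule separable_Z[OF B])
    show "(\<lambda>y. glue (mark \<F>, (y, 0))) ` Y \<subseteq> Z" using glue_Z[of _ 0] D(3) by force
    show "fst ` Z \<subseteq> Y" using D(2) by (auto simp: Z_def suspension_def glue_def)
    show "\<forall>y\<in>Y. fst (glue (mark \<F>, (y, 0))) = y" by (simp add: glue_def)
  qed (use continuum_Z indecomposable_Z joined_Z continuous_embed in auto)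
qed

section \<open>Transfer along homeomorphisms\<close>

lemma homeomorphic_continuum:
  assumes h: "homeomorphic_map X Y h" and "continuum X"
  shows "continuum Y"
proof -
  have "X homeomorphic_space Y" using h homeomorphic_map_imp_homeomorphic_space by blast
  moreover obtain x y where "x \<in> topspace X" "y \<in> topspace X" "x \<noteq> y" using assms(2) by (auto simp: continuum_def)
  moreover have "inj_on h (topspace X)" "h ` topspace X = topspace Y"
    using h homeomorphic_imp_injective_map homeomorphic_imp_surjective_map by blast+
  ultimately show ?thesis
    using assms(2) unfolding continuum_def
    by (metis homeomorphic_Hausdorff_space homeomorphic_compact_space homeomorphic_connected_space imageI inj_on_eq_iff)
qed

lemma homeomorphic_proper_subcontinuum:
  assumes h: "homeomorphic_map X Y h" and K: "proper_subcontinuum X K"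
  shows "proper_subcontinuum Y (h ` K)"
proof -
  have sub: "K \<subseteq> topspace X" using K by (simp add: proper_subcontinuum_def subcontinuum_def)
  have inj: "inj_on h (topspace X)" and surj: "h ` topspace X = topspace Y"
    using h homeomorphic_imp_injective_map homeomorphic_imp_surjective_map by blast+
  have "homeomorphic_map (subtopology X K) (subtopology Y (h ` K)) h"
    by (rule homeomorphic_map_subtopologies[OF h]) (use sub surj in auto)
  then have "continuum (subtopology Y (h ` K))"
    using K by (auto intro: homeomorphic_continuum simp: proper_subcontinuum_def subcontinuum_def)
  moreover have "h ` K \<noteq> topspace Y"
    using K sub inj surj by (metis inj_on_image_eq_iff order_refl proper_subcontinuum_def)
  ultimately show ?thesis
    using sub surj by (auto simp: proper_subcontinuum_def subcontinuum_def)
qed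

lemma homeomorphic_indecomposable:
  assumes h: "homeomorphic_map X Y h" and X: "indecomposable X"
  shows "indecomposable Y"
  unfolding indecomposable_def
proof (rule notI, elim exE conjE)
  fix A B assume AB: "proper_subcontinuum Y A" "proper_subcontinuum Y B" "topspace Y = A \<union> B"
  obtain g where g: "homeomorphic_maps X Y h g" using h homeomorphic_map_maps by blast
  then have g': "homeomorphic_map Y X g" using homeomorphic_maps_map by blast
  then have "topspace X = g ` A \<union> g ` B" using AB(3) homeomorphic_imp_surjective_map by fastforce
  then show False
    using X homeomorphic_proper_subcontinuum[OF g' AB(1)] homeomorphic_proper_subcontinuum[OF g' AB(2)]
    unfolding indecomposable_def by blast
qed


text \<open>
  The distances to the members of a countable dense set separate the points, so they give a
  continuous injection into the space of real sequences, which compactness turns into a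
  homeomorphism onto the image.
\<close>
lemma compact_metrizable_in_sequences:
  assumes "compact_space Y" "metrizable_space Y" "topspace Y \<noteq> {}"
  obtains f :: "'a \<Rightarrow> nat \<Rightarrow> real" where "homeomorphic_map Y (top_of_set (f ` topspace Y)) f"
proof -
  obtain M d where M: "Metric_space M d" and Y: "Y = Metric_space.mtopology M d"
    using assms(2) by (auto simp: metrizable_space_def)
  interpret Metric_space M d by (rule M)
  have ts: "topspace Y = M" by (simp add: Y)
  have tb: "mtotally_bounded M"
    using assms(1) compact_space_eq_mcomplete_mtotally_bounded by (simp add: Y)
  have "\<exists>K. finite K \<and> K \<subseteq> M \<and> M \<subseteq> (\<Union>x\<in>K. mball x (inverse (Suc n)))" for n
    using tb unfolding mtotally_bounded_def by (metis inverse_positive_iff_positive of_nat_0_less_iff zero_less_Suc)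
  then obtain K where K: "\<And>n. finite (K n)" "\<And>n. K n \<subseteq> M" "\<And>n. M \<subseteq> (\<Union>x\<in>K n. mball x (inverse (Suc n)))" by metis
  define B where "B = (\<Union>n. K n)"
  have B: "countable B" "B \<subseteq> M" using K by (auto simp: B_def intro: countable_finite)
  have close: "\<exists>b\<in>B. d b x < r" if x: "x \<in> M" and r: "r > 0" for x r
  proof -
    obtain n where n: "inverse (real (Suc n)) < r" using reals_Archimedean[OF r] by auto
    obtain b where "b \<in> K n" "x \<in> mball b (inverse (Suc n))" using K(3) x by blast
    then show ?thesis using n by (intro bexI[of _ b]) (auto simp: B_def)
  qed
  have "B \<noteq> {}" using close[of _ 1] assms(3) ts by fastforce
  define f where "f y = (\<lambda>n. d (from_nat_into B n) y)" for y
  have fM: "from_nat_into B n \<in> M" for n using from_nat_into[OF \<open>B \<noteq> {}\<close>] B(2) by blast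
  have "inj_on f M"
  proof (rule inj_onI, rule ccontr)
    fix x y assume xy: "x \<in> M" "y \<in> M" "f x = f y" "x \<noteq> y"
    then have "d x y / 2 > 0" by simp
    from close[OF xy(1) this] obtain b where b: "b \<in> B" "d b x < d x y / 2" by auto
    obtain n where "from_nat_into B n = b" using from_nat_into_surj[OF B(1) b(1)] by blast
    then have "d b x = d b y" using fun_cong[OF xy(3), of n] by (simp add: f_def)
    moreover have "d x y \<le> d x b + d b y" using xy b(1) B(2) by (intro triangle) auto
    ultimately show False using b(2) commute[of b x] commute[of b y] by simp
  qed
  moreover have "continuous_map Y euclidean f"
  proof -
    have "continuous_map Y euclideanreal (\<lambda>y. f y n)" for n
      using continuous_on_mdist[of "from_nat_into B n" "metric (M, d)"] fM by (simp add: f_def Y mtopology_of_def)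
    then show ?thesis
      unfolding euclidean_product_topology[symmetric] by (simp add: continuous_map_componentwise_UNIV)
  qed
  ultimately have "homeomorphic_map Y (top_of_set (f ` topspace Y)) f"
    using assms(1) by (intro continuous_imp_homeomorphic_map)
      (auto simp: ts continuous_map_in_subtopology Hausdorff_space_subtopology Hausdorff_space_euclidean_t2)
  then show thesis by (rule that)
qed


theorem theorem2:
  fixes Y :: "'a topology"
  assumes "metric_continuum Y" and "hereditarily_unicoherent Y"
  shows "\<exists>(Z :: nat set set topology) (e :: 'a \<Rightarrow> nat set set) (r :: nat set set \<Rightarrow> 'a).
           bellamy_continuum Z \<and> separable_space Z \<and>
           embedding_map Y Z e \<and> continuous_map Z Y r \<and>
           (\<forall>y\<in>topspace Y. r (e y) = y)"
proof -
  have Y: "compact_space Y" "connected_space Y" "metrizable_space Y" "topspace Y \<noteq> {}"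
    using assms(1) by (auto simp: metric_continuum_def continuum_def)
  obtain f :: "'a \<Rightarrow> nat \<Rightarrow> real" where f: "homeomorphic_map Y (top_of_set (f ` topspace Y)) f"
    using compact_metrizable_in_sequences[OF Y(1,3,4)] .
  then obtain f' where ff': "homeomorphic_maps Y (top_of_set (f ` topspace Y)) f f'"
    using homeomorphic_map_maps by blast
  define Y' where "Y' = f ` topspace Y"
  have hom: "Y homeomorphic_space top_of_set Y'"
    unfolding Y'_def using f homeomorphic_map_imp_homeomorphic_space by blast
  have "compact_space (top_of_set Y')" "connected_space (top_of_set Y')"
    using homeomorphic_compact_space[OF hom] homeomorphic_connected_space[OF hom] Y(1,2) by simp_all
  then have "compact Y'" "connected Y'"
    using compactin_subspace[of euclidean Y'] connectedin_iff_connected[of Y'] by (simp_all add: connectedin_def)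
  moreover have "Y' \<noteq> {}" using Y(4) by (simp add: Y'_def)
  ultimately obtain W :: "((nat \<Rightarrow> real) \<times> ((nat set \<times> int) option \<times> bool \<Rightarrow> real)) set" and e
    where W: "continuum (top_of_set W)" "indecomposable (top_of_set W)"
    "\<forall>x\<in>W. \<forall>y\<in>W. \<exists>K. proper_subcontinuum (top_of_set W) K \<and> x \<in> K \<and> y \<in> K"
    "separable_space (top_of_set W)" "continuous_on Y' e" "e ` Y' \<subseteq> W" "fst ` W \<subseteq> Y'" "\<forall>y\<in>Y'. fst (e y) = y"
    by (rule bellamy_retract)
  obtain Z :: "nat set set topology" where "top_of_set W homeomorphic_space Z"
    using separable_Hausdorff_space_nat_set_set[OF W(4)] W(1) by (auto simp: continuum_def)
  then obtain h h' where hh': "homeomorphic_maps (top_of_set W) Z h h'"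
    by (auto simp: homeomorphic_space_def)
  then have h: "homeomorphic_map (top_of_set W) Z h" using homeomorphic_maps_map by blast
  have "bellamy_continuum Z"
  proof (rule bellamy_continuumI)
    show "continuum Z" "indecomposable Z"
      using homeomorphic_continuum[OF h W(1)] homeomorphic_indecomposable[OF h W(2)] .
    fix x y assume xy: "x \<in> topspace Z" "y \<in> topspace Z"
    have surj: "h ` W = topspace Z" using homeomorphic_imp_surjective_map[OF h] by simp
    obtain x' where x': "x' \<in> W" "x = h x'" using xy(1) unfolding surj[symmetric] by (elim imageE)
    obtain y' where y': "y' \<in> W" "y = h y'" using xy(2) unfolding surj[symmetric] by (elim imageE)
    obtain K where K: "proper_subcontinuum (top_of_set W) K" "x' \<in> K" "y' \<in> K" using W(3)[rule_format, OF x'(1) y'(1)] by (elim exE conjE)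
    show "\<exists>K. proper_subcontinuum Z K \<and> x \<in> K \<and> y \<in> K"
      using homeomorphic_proper_subcontinuum[OF h K(1)] x'(2) y'(2) K(2,3) by (intro exI[of _ "h ` K"]) simp
  qed
  moreover have "separable_space Z"
    using W(4) h homeomorphic_separable_space homeomorphic_map_imp_homeomorphic_space by blast
  moreover define emb where "emb = h \<circ> (e \<circ> f)"
  moreover define ret where "ret = f' \<circ> (fst \<circ> h')"
  have contE: "continuous_map Y Z emb"
    unfolding emb_def
  proof (intro continuous_map_compose)
    show "continuous_map Y (top_of_set Y') f" using ff' by (simp add: homeomorphic_maps_def Y'_def)
    show "continuous_map (top_of_set Y') (top_of_set W) e" using W(5,6) by (auto simp: continuous_map_in_subtopology)
    show "continuous_map (top_of_set W) Z h" using hh' by (simp add: homeomorphic_maps_def)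
  qed
  moreover have contR: "continuous_map Z Y ret"
    unfolding ret_def
  proof (intro continuous_map_compose)
    show "continuous_map Z (top_of_set W) h'" using hh' by (simp add: homeomorphic_maps_def)
    show "continuous_map (top_of_set W) (top_of_set Y') fst"
      using W(7) by (auto simp: continuous_map_in_subtopology intro: continuous_on_fst continuous_on_id)
    show "continuous_map (top_of_set Y') Y f'" using ff' by (simp add: homeomorphic_maps_def Y'_def)
  qed
  moreover have RE: "ret (emb y) = y" if "y \<in> topspace Y" for y
  proof -
    have "f y \<in> Y'" using that by (simp add: Y'_def)
    moreover from this have "e (f y) \<in> W" using W(6) by blast
    ultimately show ?thesis
      using W(8) ff' hh' that by (simp add: ret_def emb_def homeomorphic_maps_def)
  qed
  moreover have "embedding_map Y Z emb"
    by (rule section_imp_embedding_map) (use contE contR RE in \<open>auto simp: section_map_def retraction_maps_def\<close>)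
  ultimately show ?thesis by blast
qed
end
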